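(* Let $\gamma>0$ and let $B^s$ be the Brownian motion on $\mathbb{R}_+=[0,+\infty)$ with sticky origin and stickiness parameter $\gamma$ (defined in the context). Let $A^s$ be the generator of its semigroup on $C_0(\mathbb{R}_+)$. Then the domain $\mathcal{D}(A^s)$ is equal to the space of functions $f\in C_0^2(\mathbb{R}_+)$ such that $$\frac{\gamma}{2}\,f''(0+)=f'(0+).$$
   Context: Setting. $(\Omega,\mathcal{A})$ is a measurable space with probability measures $(P_x,\,x\in\mathbb{R})$ and a right continuous filtration $\mathcal{F}=(\mathcal{F}_t,\,t\ge0)$, complete with respect to $(P_x)$; $B=(B_t,\,t\ge0)$ is a standard one-dimensional Brownian motion relative to $\mathcal{F}$ with $P_x(B_0=x)=1$, equipped with shift operators $\theta_t:\Omega\to\Omega$ with $B_s\circ\theta_t=B_{s+t}$. $L=(L_t,\,t\ge0)$ is the local time of $B$ at $0$, normalized so that Tanaka's formula reads $d|B_t|=\operatorname{sign}(B_t)\,dB_t+dL_t$. All paths of $B$ and $L$ are continuous. Sticky Brownian motion. For $\gamma>0$ let $\tau^{-1}(t)=t+\gamma L_t$, $t\ge0$; this is a strictly increasing continuous bijection of $\mathbb{R}_+$ and $\tau$ denotes its inverse. Put $B^s_t=|B_{\tau(t)}|$, $t\ge0$. The semigroup is $U^s_tf(x)=E_x(f(B^s_t))$, $x\in\mathbb{R}_+$, and $A^s$ is its infinitesimal generator on $C_0(\mathbb{R}_+)$. $C_0(\mathbb{R}_+)$ is the space of real continuous functions on $[0,+\infty)$ vanishing at infinity. $C_0^2(\mathbb{R}_+)$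 is the subspace of those $f\in C_0(\mathbb{R}_+)$ that are twice continuously differentiable on $(0,+\infty)$ and such that $f''$ extends to a continuous function on $[0,+\infty)$; for such $f$ the finite right limits $f'(0+)$, $f''(0+)$ at $0$ exist.
   Formalization: C_0^2(R_+) is taken to require that f'' extend to a function in C_0(R_+), i.e. also vanish at infinity, not merely to a continuous function on [0,∞); otherwise f(x)=x^3 sin(x^3)/(1+x^4) satisfies the condition but has f'' unbounded, so is not in the domain. *)

theory Defs
  imports "HOL-Probability.Probability"
begin

section \<open>Brownian motion relative to a filtration\<close>

text \<open>
  \<open>M\<close> only carries the measurable space; its measure plays no role.  Time is \<open>[0,\<infinity>)\<close> inside
  \<open>real\<close>: nothing is required of \<open>F\<close>, \<open>B\<close> and \<open>\<theta>\<close> at negative times, which is why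
  \<open>max 0\<close> occurs where the library locale wants a filtration indexed by all of \<open>real\<close>.

  Completeness of \<open>F\<close> with respect to the family \<open>P\<close> is taken in its weakest form: subsets
  of \<open>space M\<close> that are negligible under every \<open>P x\<close> (with a cover that may depend
  on \<open>x\<close>) belong to \<open>F 0\<close>.
\<close>

locale brownian_family =
  fixes M :: "'a measure"
    and P :: "real \<Rightarrow> 'a measure"
    and F :: "real \<Rightarrow> 'a measure"
    and B :: "real \<Rightarrow> 'a \<Rightarrow> real"
    and \<theta> :: "real \<Rightarrow> 'a \<Rightarrow> 'a"
  assumes prob_space_P: "\<And>x. prob_space (P x)"
    and sets_P: "\<And>x. sets (P x) = sets M"
    and filtration_F: "filtration (space M) (\<lambda>t. F (max 0 t))"
    and subalgebra_F: "\<And>t. 0 \<le> t \<Longrightarrow> subalgebra M (F t)"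
    and right_continuous_F: "\<And>t. 0 \<le> t \<Longrightarrow> sets (F t) = (\<Inter>s\<in>{t<..}. sets (F s))"
    and complete_F:
      "\<And>N. N \<subseteq> space M \<Longrightarrow> (\<And>x. \<exists>N'\<in>null_sets (P x). N \<subseteq> N') \<Longrightarrow> N \<in> sets (F 0)"
    and adapted_B: "\<And>t. 0 \<le> t \<Longrightarrow> B t \<in> borel_measurable (F t)"
    and continuous_B: "\<And>\<omega>. \<omega> \<in> space M \<Longrightarrow> continuous_on {0..} (\<lambda>t. B t \<omega>)"
    and start_B: "\<And>x. measure (P x) {\<omega> \<in> space M. B 0 \<omega> = x} = 1"
    and normal_increments_B:
      "\<And>x s t. 0 \<le> s \<Longrightarrow> s < t \<Longrightarrow>
        distributed (P x) lborel (\<lambda>\<omega>. B t \<omega> - B s \<omega>) (normal_density 0 (sqrt (t - s)))"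
    and indep_increments_B:
      "\<And>x s t. 0 \<le> s \<Longrightarrow> s < t \<Longrightarrow>
        prob_space.indep_set (P x) (sets (F s))
          (sets (vimage_algebra (space M) (\<lambda>\<omega>. B t \<omega> - B s \<omega>) borel))"
    and shift_space: "\<And>t \<omega>. 0 \<le> t \<Longrightarrow> \<omega> \<in> space M \<Longrightarrow> \<theta> t \<omega> \<in> space M"
    and shift_B: "\<And>s t \<omega>. 0 \<le> s \<Longrightarrow> 0 \<le> t \<Longrightarrow> \<omega> \<in> space M \<Longrightarrow> B s (\<theta> t \<omega>) = B (s + t) \<omega>"


section \<open>The Ito integral with respect to Brownian motion\<close>

text \<open>
  An elementary integrand is given by a number \<open>n\<close> of steps, a partition \<open>u\<close> and coefficients
  \<open>\<xi>\<close>; it is the process \<open>\<Sum>i<n. \<xi> i * 1_(u i, u (i+1)]\<close>.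
\<close>

type_synonym 'a elementary = "nat \<times> (nat \<Rightarrow> real) \<times> (nat \<Rightarrow> 'a \<Rightarrow> real)"

fun elementary_integrand :: "(real \<Rightarrow> 'a measure) \<Rightarrow> 'a elementary \<Rightarrow> bool" where
  "elementary_integrand F (n, u, \<xi>) \<longleftrightarrow>
     0 \<le> u 0 \<and>
     (\<forall>i<n. u i \<le> u (Suc i) \<and> \<xi> i \<in> borel_measurable (F (u i)) \<and>
            (\<exists>C. \<forall>\<omega>\<in>space (F (u i)). \<bar>\<xi> i \<omega>\<bar> \<le> C))"

fun elementary_process :: "'a elementary \<Rightarrow> real \<Rightarrow> 'a \<Rightarrow> real" where
  "elementary_process (n, u, \<xi>) s \<omega> = (\<Sum>i<n. \<xi> i \<omega> * indicator {u i<..u (Suc i)} s)"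

fun elementary_integral :: "(real \<Rightarrow> 'a \<Rightarrow> real) \<Rightarrow> 'a elementary \<Rightarrow> real \<Rightarrow> 'a \<Rightarrow> real" where
  "elementary_integral B (n, u, \<xi>) t \<omega> =
     (\<Sum>i<n. \<xi> i \<omega> * (B (min t (u (Suc i))) \<omega> - B (min t (u i)) \<omega>))"

text \<open>
  \<open>I t = \<integral>\<^sub>0\<^sup>t H dB\<close> under the probability measure \<open>Q\<close>, for every \<open>t \<ge> 0\<close>, as the \<open>L\<^sup>2\<close> limit of
  elementary integrals.  By the Ito isometry \<open>I t\<close> is unique up to \<open>Q\<close>-null sets.  The
  \<open>nn_integral\<close>s take the value \<open>\<infinity>\<close> when square integrability fails, so the two
  limits include it.
\<close>

definition is_ito_integral ::
  "'a measure \<Rightarrow> (real \<Rightarrow> 'a measure) \<Rightarrow> (real \<Rightarrow> 'a \<Rightarrow> real) \<Rightarrow>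
   (real \<Rightarrow> 'a \<Rightarrow> real) \<Rightarrow> (real \<Rightarrow> 'a \<Rightarrow> real) \<Rightarrow> bool" where
  "is_ito_integral Q F B H I \<longleftrightarrow>
     (\<forall>T\<ge>0.
        (\<lambda>(s, \<omega>). H s \<omega>) \<in> borel_measurable (restrict_space borel {0..T} \<Otimes>\<^sub>M F T) \<and>
        I T \<in> borel_measurable (F T) \<and>
        (\<exists>E :: nat \<Rightarrow> 'a elementary.
           (\<forall>k. elementary_integrand F (E k)) \<and>
           (\<lambda>k. \<integral>\<^sup>+\<omega>. (\<integral>\<^sup>+s\<in>{0..T}. ennreal ((H s \<omega> - elementary_process (E k) s \<omega>)\<^sup>2) \<partial>lborel) \<partial>Q)
             \<longlonglongrightarrow> 0 \<and>
           (\<lambda>k. \<integral>\<^sup>+\<omega>. ennreal ((I T \<omega> - elementary_integral B (E k) T \<omega>)\<^sup>2) \<partial>Q) \<longlonglongrightarrow> 0))"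


section \<open>Local time at the origin\<close>

text \<open>
  Tanaka's formula \<open>|B\<^sub>t| = |B\<^sub>0| + \<integral>\<^sub>0\<^sup>t sign(B\<^sub>s) dB\<^sub>s + L\<^sub>t\<close> under every \<open>P x\<close> is the defining
  property of \<open>L\<close>, including its normalization.  The value of the sign at \<open>0\<close> (here \<open>sgn 0 = 0\<close>)
  does not matter, as \<open>{s. B\<^sub>s = 0}\<close> is almost surely Lebesgue-null.  That all paths (and not just
  almost all) start at \<open>0\<close> and increase makes \<open>t \<mapsto> t + \<gamma> L\<^sub>t\<close> a strictly increasing continuous
  bijection of \<open>[0,\<infinity>)\<close> for every \<open>\<omega>\<close> and every \<open>\<gamma> > 0\<close>.
\<close>

locale brownian_local_time = brownian_family M P F B \<theta>
  for M :: "'a measure"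
    and P :: "real \<Rightarrow> 'a measure"
    and F :: "real \<Rightarrow> 'a measure"
    and B :: "real \<Rightarrow> 'a \<Rightarrow> real"
    and \<theta> :: "real \<Rightarrow> 'a \<Rightarrow> 'a" +
  fixes L :: "real \<Rightarrow> 'a \<Rightarrow> real"
  assumes adapted_L: "\<And>t. 0 \<le> t \<Longrightarrow> L t \<in> borel_measurable (F t)"
    and continuous_L: "\<And>\<omega>. \<omega> \<in> space M \<Longrightarrow> continuous_on {0..} (\<lambda>t. L t \<omega>)"
    and start_L: "\<And>\<omega>. \<omega> \<in> space M \<Longrightarrow> L 0 \<omega> = 0"
    and mono_L: "\<And>\<omega>. \<omega> \<in> space M \<Longrightarrow> mono_on {0..} (\<lambda>t. L t \<omega>)"
    and tanaka:
      "\<And>x. is_ito_integral (P x) F B (\<lambda>t \<omega>. sgn (B t \<omega>)) (\<lambda>t \<omega>. \<bar>B t \<omega>\<bar> - \<bar>B 0 \<omega>\<bar> - L t \<omega>)"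


section \<open>Sticky Brownian motion and its semigroup\<close>

definition sticky_clock :: "real \<Rightarrow> (real \<Rightarrow> 'a \<Rightarrow> real) \<Rightarrow> real \<Rightarrow> 'a \<Rightarrow> real" where
  "sticky_clock \<gamma> L t \<omega> = the_inv_into {0..} (\<lambda>s. s + \<gamma> * L s \<omega>) t"

definition sticky_bm ::
  "real \<Rightarrow> (real \<Rightarrow> 'a \<Rightarrow> real) \<Rightarrow> (real \<Rightarrow> 'a \<Rightarrow> real) \<Rightarrow> real \<Rightarrow> 'a \<Rightarrow> real" where
  "sticky_bm \<gamma> B L t \<omega> = \<bar>B (sticky_clock \<gamma> L t \<omega>) \<omega>\<bar>"

definition sticky_semigroup ::
  "(real \<Rightarrow> 'a measure) \<Rightarrow> real \<Rightarrow> (real \<Rightarrow> 'a \<Rightarrow> real) \<Rightarrow> (real \<Rightarrow> 'a \<Rightarrow> real) \<Rightarrow>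
   real \<Rightarrow> (real \<Rightarrow> real) \<Rightarrow> real \<Rightarrow> real" where
  "sticky_semigroup P \<gamma> B L t f x = (\<integral>\<omega>. f (sticky_bm \<gamma> B L t \<omega>) \<partial>P x)"


section \<open>Function spaces on the half-line and generators\<close>

text \<open>
  Functions on \<open>[0,\<infinity>)\<close> are represented by functions on \<open>real\<close> of which only the values on
  \<open>{0..}\<close> are ever used, so each of the sets below is closed under changing a member
  on the negative half-line.
\<close>

definition C0_Rplus :: "(real \<Rightarrow> real) set" where
  "C0_Rplus = {f. continuous_on {0..} f \<and> (f \<longlongrightarrow> 0) at_top}"

text \<open>
  The subscript in \<open>C\<^sub>0\<^sup>2\<close> is read as also applying to the second derivative: \<open>f''\<close> extends to an
  element of \<open>C\<^sub>0\<close>, not merely to a continuous function on \<open>[0,\<infinity>)\<close>.  Since the generator acts as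
  \<open>f''/2\<close> with values in \<open>C\<^sub>0\<close>, vanishing of \<open>f''\<close> at infinity is necessary, and it is not
  automatic: \<open>f x = x\<^sup>3 * sin (x ^ 3) / (1 + x ^ 4)\<close> satisfies all the other requirements and
  \<open>f'(0+) = f''(0+) = 0\<close>, but \<open>f''\<close> is unbounded.
\<close>

definition C02_Rplus :: "(real \<Rightarrow> real) set" where
  "C02_Rplus =
     {f \<in> C0_Rplus.
        f differentiable_on {0<..} \<and> deriv f differentiable_on {0<..} \<and>
        continuous_on {0<..} (deriv (deriv f)) \<and>
        (\<exists>g\<in>C0_Rplus. \<forall>x>0. deriv (deriv f) x = g x)}"

definition generator_value ::
  "(real \<Rightarrow> (real \<Rightarrow> real) \<Rightarrow> real \<Rightarrow> real) \<Rightarrow> (real \<Rightarrow> real) \<Rightarrow> (real \<Rightarrow> real) \<Rightarrow> bool" where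
  "generator_value U f g \<longleftrightarrow>
     f \<in> C0_Rplus \<and> g \<in> C0_Rplus \<and>
     uniform_limit {0..} (\<lambda>t x. (U t f x - f x) / t) g (at_right 0)"

definition generator_domain ::
  "(real \<Rightarrow> (real \<Rightarrow> real) \<Rightarrow> real \<Rightarrow> real) \<Rightarrow> (real \<Rightarrow> real) set" where
  "generator_domain U = {f. \<exists>g. generator_value U f g}"

text \<open>
  \<open>f'(0+)\<close> and \<open>f''(0+)\<close>; both limits exist for \<open>f \<in> C02_Rplus\<close>.
\<close>

definition right_deriv_0 :: "(real \<Rightarrow> real) \<Rightarrow> real" where
  "right_deriv_0 f = Lim (at_right 0) (deriv f)"

definition right_deriv2_0 :: "(real \<Rightarrow> real) \<Rightarrow> real" where
  "right_deriv2_0 f = Lim (at_right 0) (deriv (deriv f))"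

end

theory Submission
  imports Defs "HOL-Real_Asymp.Real_Asymp"
begin

text \<open>
  Write \<open>\<tau>\<close> for the clock at time \<open>t\<close> and \<open>l = E\<^sub>x L\<^sub>\<tau>\<close>.  Since \<open>\<tau> \<le> t\<close> is a stopping time, optional
  stopping for \<open>B\<close>, \<open>B\<^sup>2 - t\<close> and the Tanaka martingale \<open>\<bar>B\<bar> - L\<close> yields the first two moments of
  \<open>\<bar>B\<^sub>\<tau>\<bar> - x\<close>, namely \<open>l\<close> and \<open>E\<^sub>x \<tau> - 2 x l\<close>, where \<open>\<tau> + \<gamma> L\<^sub>\<tau> = t\<close>.  A second order Taylor expansion of \<open>f\<close>
  at \<open>x\<close> then gives \<open>U\<^sub>t f x = f x + t f''(x) / 2 + l (f'(x) - \<gamma> f''(x) / 2 - x f''(x)) + o(t)\<close>,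
  uniformly in \<open>x\<close>.  The term with \<open>l\<close> is \<open>o(t)\<close>: near \<open>0\<close> because \<open>\<gamma> l \<le> t\<close> and the boundary condition
  makes the bracket small, away from \<open>0\<close> because \<open>l\<close> is of order \<open>t\<^sup>2 / x\<^sup>3\<close>.  So every \<open>f\<close> satisfying
  the boundary condition is in the domain.  Conversely, given \<open>f\<close> in the domain, the equation
  \<open>(1/2 - A) v = (1/2 - A) f\<close> has an explicit solution \<open>v\<close> satisfying the boundary condition, and
  \<open>v = f\<close> by the maximum principle.  Neither the Markov property nor Ito's formula is needed.
\<close>

section \<open>Twice differentiable functions on the half-line\<close>

text \<open>Two obstacles shape the proof. The hypothesis on the Ito integral describes
  \<open>I T\<close> for each \<open>T\<close> through its own approximating sequence, so it does
  not relate \<open>I s\<close> to \<open>I t\<close>. The martingale property of \<bar>B\<bar> - L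
  is recovered by comparing the two sequences on [0, s] with the help of the isometry. Moreover the
  clock takes a continuum of values. It is rounded up to a grid of mesh t / n, where optional
  stopping is a finite telescoping sum over events of the filtration, and dominated convergence
  removes the mesh. Fourth moments of the stopped increment, bounded by 9 t^2 on every grid, are
  used twice: they absorb the Taylor error at distant points, and they give the decay of l away from
  0. The value 1/2 of the resolvent parameter turns the equation for v into v - v'' = k, whose
  homogeneous solutions are exp(x) and exp(- x). Since v satisfies the boundary condition, the
  expansion already puts it in the domain. Only uniqueness for A u = u / 2 is then missing, and this
  needs nothing of the semigroup beyond its being given by expectations.\<close>

definition smooth_rep :: "(real \<Rightarrow> real) \<Rightarrow> (real \<Rightarrow> real) \<Rightarrow> (real \<Rightarrow> real) \<Rightarrow> bool" where
  "smooth_rep f f1 g \<longleftrightarrow> f \<in> C0_Rplus \<and> g \<in> C0_Rplus \<and>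
     (\<forall>x\<ge>0. (f has_real_derivative f1 x) (at x within {0..})) \<and>
     (\<forall>x\<ge>0. (f1 has_real_derivative g x) (at x within {0..}))"

lemma C0_Rplus_bounded:
  assumes "f \<in> C0_Rplus"
  obtains C where "C > 0" "\<And>x. 0 \<le> x \<Longrightarrow> \<bar>f x\<bar> \<le> C"
proof -
  have cont: "continuous_on {0..} f" and lim: "(f \<longlongrightarrow> 0) at_top"
    using assms by (auto simp: C0_Rplus_def)
  from lim have "\<forall>\<^sub>F x in at_top. dist (f x) 0 < 1"
    by (rule tendstoD) simp
  then obtain N where N: "\<And>x. x \<ge> N \<Longrightarrow> \<bar>f x\<bar> < 1"
    by (auto simp: eventually_at_top_linorder dist_real_def)
  have "compact (f ` {0..max 0 N})"
    by (intro compact_continuous_image continuous_on_subset[OF cont]) auto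
  then obtain C where "\<forall>y\<in>f ` {0..max 0 N}. norm y \<le> C"
    using compact_imp_bounded[of "f ` {0..max 0 N}"] bounded_iff by blast
  then have C: "\<bar>f x\<bar> \<le> C" if "x \<in> {0..max 0 N}" for x
    using that by fastforce
  show thesis
  proof (rule that)
    fix x :: real assume "0 \<le> x"
    then show "\<bar>f x\<bar> \<le> max 1 C"
      using C[of x] N[of x] by (cases "x \<le> N") auto
  qed simp
qed

lemma C0_Rplus_uniformly_continuous:
  assumes "f \<in> C0_Rplus" "e > 0"
  obtains d where "d > 0" "\<And>x y. 0 \<le> x \<Longrightarrow> 0 \<le> y \<Longrightarrow> \<bar>y - x\<bar> < d \<Longrightarrow> \<bar>f y - f x\<bar> < e"
proof -
  have cont: "continuous_on {0..} f" and lim: "(f \<longlongrightarrow> 0) at_top"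
    using assms by (auto simp: C0_Rplus_def)
  from lim have "\<forall>\<^sub>F x in at_top. dist (f x) 0 < e / 2"
    by (rule tendstoD) (use assms in simp)
  then obtain N where N: "\<And>x. x \<ge> N \<Longrightarrow> \<bar>f x\<bar> < e / 2"
    by (auto simp: eventually_at_top_linorder dist_real_def)
  have "uniformly_continuous_on {0..max 0 N + 1} f"
    by (intro compact_uniformly_continuous continuous_on_subset[OF cont]) auto
  then obtain d where d: "d > 0"
    "\<And>x y. x \<in> {0..max 0 N + 1} \<Longrightarrow> y \<in> {0..max 0 N + 1} \<Longrightarrow> dist y x < d \<Longrightarrow> dist (f y) (f x) < e"
    using assms(2) unfolding uniformly_continuous_on_def by metis
  show thesis
  \<comment> \<open>At distance below 1, a point beyond \<open>max 0 N + 1\<close> forces the other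
    one beyond \<open>N\<close>: either both points lie in the compact interval or both values are
    below \<open>e / 2\<close>.\<close>
  proof (rule that[of "min d 1"])
    fix x y :: real assume *: "0 \<le> x" "0 \<le> y" "\<bar>y - x\<bar> < min d 1"
    show "\<bar>f y - f x\<bar> < e"
    proof (cases "x \<le> max 0 N + 1 \<and> y \<le> max 0 N + 1")
      case True
      then show ?thesis using d(2)[of x y] * by (auto simp: dist_real_def)
    next
      case False
      then have "\<bar>f x\<bar> < e / 2" "\<bar>f y\<bar> < e / 2"
        using * by (intro N; linarith)+
      then show ?thesis by linarith
    qed
  qed (use d in simp)
qed

lemma mean_value_bound_Rplus:
  fixes f f' :: "real \<Rightarrow> real"
  assumes der: "\<And>z. 0 \<le> z \<Longrightarrow> (f has_real_derivative f' z) (at z within {0..})"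
    and xy: "0 \<le> x" "0 \<le> y"
    and bound: "\<And>z. 0 \<le> z \<Longrightarrow> \<bar>z - x\<bar> \<le> \<bar>y - x\<bar> \<Longrightarrow> \<bar>f' z\<bar> \<le> K"
  shows "\<bar>f y - f x\<bar> \<le> K * \<bar>y - x\<bar>"
proof -
  have "norm (f y - f x) \<le> K * norm (y - x)"
  proof (rule field_differentiable_bound[of "{min x y..max x y}" f f'])
    fix z assume z: "z \<in> {min x y..max x y}"
    then show "(f has_real_derivative f' z) (at z within {min x y..max x y})"
      using xy by (intro DERIV_subset[OF der]) (auto simp: min_def max_def split: if_splits)
    show "norm (f' z) \<le> K"
      using z xy by (auto intro!: bound simp: min_def max_def split: if_splits)
  qed auto
  then show ?thesis by simp
qed

text \<open>Over a unit step the increment of \<open>f\<close> differs from \<open>f1 x\<close> by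
  at most the bound of \<open>g\<close>, so bounds on \<open>f\<close> and on its second derivative
  bound the first one.\<close>

lemma smooth_rep_bounded_deriv:
  assumes "smooth_rep f f1 g"
  obtains C where "C > 0" "\<And>x. 0 \<le> x \<Longrightarrow> \<bar>f1 x\<bar> \<le> C"
proof -
  obtain Cf where Cf: "Cf > 0" "\<And>x. 0 \<le> x \<Longrightarrow> \<bar>f x\<bar> \<le> Cf"
    using assms C0_Rplus_bounded[of f] unfolding smooth_rep_def by blast
  obtain Cg where Cg: "Cg > 0" "\<And>x. 0 \<le> x \<Longrightarrow> \<bar>g x\<bar> \<le> Cg"
    using assms C0_Rplus_bounded[of g] unfolding smooth_rep_def by blast
  have bd: "\<bar>f1 x\<bar> \<le> 2 * Cf + Cg" if x: "0 \<le> x" for x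
  proof -
    define \<phi> where "\<phi> z = f z - f1 x * z" for z
    have "\<bar>\<phi> (x + 1) - \<phi> x\<bar> \<le> Cg * \<bar>(x + 1) - x\<bar>"
    proof (rule mean_value_bound_Rplus[where f' = "\<lambda>z. f1 z - f1 x"])
      fix z :: real assume z: "0 \<le> z"
      show "(\<phi> has_real_derivative f1 z - f1 x) (at z within {0..})"
        unfolding \<phi>_def using assms z unfolding smooth_rep_def
        by (auto intro!: derivative_eq_intros)
      assume zx: "\<bar>z - x\<bar> \<le> \<bar>x + 1 - x\<bar>"
      have "\<bar>f1 z - f1 x\<bar> \<le> Cg * \<bar>z - x\<bar>"
        by (rule mean_value_bound_Rplus[where f' = g])
           (use assms z x Cg in \<open>auto simp: smooth_rep_def\<close>)
      also have "\<dots> \<le> Cg * 1" using zx Cg by (intro mult_left_mono) auto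
      finally show "\<bar>f1 z - f1 x\<bar> \<le> Cg" by simp
    qed (use x in auto)
    then show ?thesis using Cf(2)[of x] Cf(2)[of "x + 1"] x
      unfolding \<phi>_def by (auto simp: algebra_simps)
  qed
  show thesis by (rule that[of "2 * Cf + Cg"]) (use bd Cf Cg in auto)
qed

text \<open>Within the modulus \<open>d\<close> of uniform continuity of \<open>g\<close>, the
  remainder is at most e (y - x)^2, uniformly in \<open>x\<close>. Beyond \<open>d\<close> the crude
  bound 2 Cg (y - x)^2 is absorbed by the fourth power, whose mean over the stopped path will be of
  order t^2.\<close>

lemma smooth_rep_taylor:
  assumes rep: "smooth_rep f f1 g" and e: "e > 0"
  obtains C where "C > 0"
    "\<And>x y. 0 \<le> x \<Longrightarrow> 0 \<le> y \<Longrightarrow>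
      \<bar>f y - f x - f1 x * (y - x) - g x / 2 * (y - x)\<^sup>2\<bar> \<le> e * (y - x)\<^sup>2 + C * (y - x) ^ 4"
proof -
  have g: "g \<in> C0_Rplus" and
    df: "\<And>x. 0 \<le> x \<Longrightarrow> (f has_real_derivative f1 x) (at x within {0..})" and
    df1: "\<And>x. 0 \<le> x \<Longrightarrow> (f1 has_real_derivative g x) (at x within {0..})"
    using rep by (auto simp: smooth_rep_def)
  obtain Cg where Cg: "Cg > 0" "\<And>x. 0 \<le> x \<Longrightarrow> \<bar>g x\<bar> \<le> Cg"
    using C0_Rplus_bounded[OF g] by blast
  obtain d where d: "d > 0" "\<And>x y. 0 \<le> x \<Longrightarrow> 0 \<le> y \<Longrightarrow> \<bar>y - x\<bar> < d \<Longrightarrow> \<bar>g y - g x\<bar> < e"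
    using C0_Rplus_uniformly_continuous[OF g e] by blast
  show thesis
  proof (rule that[of "2 * Cg / d\<^sup>2"])
    fix x y :: real assume x: "0 \<le> x" and y: "0 \<le> y"
    \<comment> \<open>The mean value bound is used twice, for \<open>f1\<close> and for
      \<open>f\<close>, each time after subtracting the Taylor polynomial. This loses the factor 1/2
      of the sharp remainder.\<close>
    have main: "\<bar>f y - f x - f1 x * (y - x) - g x / 2 * (y - x)\<^sup>2\<bar> \<le> K * (y - x)\<^sup>2"
      if K: "\<And>z. 0 \<le> z \<Longrightarrow> \<bar>z - x\<bar> \<le> \<bar>y - x\<bar> \<Longrightarrow> \<bar>g z - g x\<bar> \<le> K" for K
    proof -
      have K0: "0 \<le> K" using K[of x] x by simp
      define \<phi> where "\<phi> z = f z - f x - f1 x * (z - x) - g x / 2 * (z - x)\<^sup>2" for z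
      have "\<bar>\<phi> y - \<phi> x\<bar> \<le> (K * \<bar>y - x\<bar>) * \<bar>y - x\<bar>"
      proof (rule mean_value_bound_Rplus[where f' = "\<lambda>z. f1 z - f1 x - g x * (z - x)"])
        fix z :: real assume z: "0 \<le> z"
        show "(\<phi> has_real_derivative f1 z - f1 x - g x * (z - x)) (at z within {0..})"
          unfolding \<phi>_def by (rule derivative_eq_intros df z refl | simp)+
        assume zx: "\<bar>z - x\<bar> \<le> \<bar>y - x\<bar>"
        have "\<bar>(f1 z - g x * z) - (f1 x - g x * x)\<bar> \<le> K * \<bar>z - x\<bar>"
        proof (rule mean_value_bound_Rplus[where f' = "\<lambda>w. g w - g x"])
          fix w :: real assume w: "0 \<le> w"
          show "((\<lambda>a. f1 a - g x * a) has_real_derivative g w - g x) (at w within {0..})"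
            by (rule derivative_eq_intros df1 w refl | simp)+
          assume "\<bar>w - x\<bar> \<le> \<bar>z - x\<bar>"
          then show "\<bar>g w - g x\<bar> \<le> K" using zx w by (intro K) auto
        qed (use x z in auto)
        also have "\<dots> \<le> K * \<bar>y - x\<bar>" using zx K0 by (intro mult_left_mono)
        finally show "\<bar>f1 z - f1 x - g x * (z - x)\<bar> \<le> K * \<bar>y - x\<bar>"
          by (simp add: algebra_simps)
      qed (use x y in auto)
      then show ?thesis by (simp add: \<phi>_def power2_eq_square)
    qed
    show "\<bar>f y - f x - f1 x * (y - x) - g x / 2 * (y - x)\<^sup>2\<bar>
        \<le> e * (y - x)\<^sup>2 + 2 * Cg / d\<^sup>2 * (y - x) ^ 4"
    proof (cases "\<bar>y - x\<bar> < d")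
      case True
      have "\<bar>f y - f x - f1 x * (y - x) - g x / 2 * (y - x)\<^sup>2\<bar> \<le> e * (y - x)\<^sup>2"
        by (rule main) (use d(2)[of x] x True in force)
      also have "\<dots> \<le> e * (y - x)\<^sup>2 + 2 * Cg / d\<^sup>2 * (y - x) ^ 4" using Cg by simp
      finally show ?thesis .
    next
      case False
      have "\<bar>f y - f x - f1 x * (y - x) - g x / 2 * (y - x)\<^sup>2\<bar> \<le> (2 * Cg) * (y - x)\<^sup>2"
      proof (rule main)
        fix z :: real assume "0 \<le> z"
        then show "\<bar>g z - g x\<bar> \<le> 2 * Cg" using Cg(2)[of z] Cg(2)[of x] x by linarith
      qed
      also have "\<dots> = 2 * Cg / d\<^sup>2 * (d\<^sup>2 * (y - x)\<^sup>2)" using d by simp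
      also have "\<dots> \<le> 2 * Cg / d\<^sup>2 * ((y - x)\<^sup>2 * (y - x)\<^sup>2)"
        using False d Cg power_mono[of d "\<bar>y - x\<bar>" 2]
        by (intro mult_left_mono mult_right_mono) auto
      also have "\<dots> = 2 * Cg / d\<^sup>2 * (y - x) ^ 4" by (simp flip: power_add)
      also have "\<dots> \<le> e * (y - x)\<^sup>2 + 2 * Cg / d\<^sup>2 * (y - x) ^ 4" using e by simp
      finally show ?thesis .
    qed
  qed (use Cg d in auto)
qed


lemma continuous_on_at_right_0:
  fixes f :: "real \<Rightarrow> real"
  assumes "continuous_on {0..} f"
  shows "(f \<longlongrightarrow> f 0) (at_right 0)"
proof -
  have "(f \<longlongrightarrow> f 0) (at 0 within {0..})"
    using assms unfolding continuous_on_def by (metis atLeast_iff order_refl)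
  then show ?thesis by (simp only: at_within_Ici_at_right)
qed

text \<open>Away from 0 the one-sided derivatives coincide with \<open>deriv\<close>; at 0
  continuity of \<open>f1\<close> and \<open>g\<close> identifies the limits.\<close>

lemma smooth_rep_C02:
  assumes "smooth_rep f f1 g"
  shows "f \<in> C02_Rplus" "right_deriv_0 f = f1 0" "right_deriv2_0 f = g 0"
proof -
  have C0: "f \<in> C0_Rplus" "g \<in> C0_Rplus"
    and df: "\<And>x. 0 \<le> x \<Longrightarrow> (f has_real_derivative f1 x) (at x within {0..})"
    and df1: "\<And>x. 0 \<le> x \<Longrightarrow> (f1 has_real_derivative g x) (at x within {0..})"
    using assms by (auto simp: smooth_rep_def)
  have at: "at x within {0..} = at x" if "0 < x" for x :: real
    using that by (intro at_within_interior) (simp add: interior_real_atLeast)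
  have f: "(f has_real_derivative f1 x) (at x)" and f1: "(f1 has_real_derivative g x) (at x)"
    if "0 < x" for x
    using df[of x] df1[of x] at[OF that] that by auto
  have d1: "deriv f x = f1 x" if "0 < x" for x
    by (rule DERIV_imp_deriv[OF f[OF that]])
  have d1': "(deriv f has_real_derivative g x) (at x)" if "0 < x" for x
    by (rule has_field_derivative_transform_within_open[OF f1[OF that], of "{0<..}"])
       (use d1 that in auto)
  have d2: "deriv (deriv f) x = g x" if "0 < x" for x
    by (rule DERIV_imp_deriv[OF d1'[OF that]])
  have cg: "continuous_on {0..} g" using C0 by (simp add: C0_Rplus_def)
  show "f \<in> C02_Rplus"
    unfolding C02_Rplus_def
  proof (intro CollectI conjI C0 bexI[of _ g] allI impI d2)
    show "f differentiable_on {0<..}" "deriv f differentiable_on {0<..}"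
      using f d1' by (auto simp: differentiable_on_def real_differentiable_def
        intro: has_field_derivative_at_within)
    have "continuous_on {0<..} g" by (rule continuous_on_subset[OF cg]) auto
    then show "continuous_on {0<..} (deriv (deriv f))"
      by (rule continuous_on_eq) (simp add: d2)
  qed
  have ev: "\<forall>\<^sub>F x in at_right 0. (0::real) < x"
    by (simp add: eventually_at_right_less)
  have "(f1 \<longlongrightarrow> f1 0) (at_right 0)"
    by (intro continuous_on_at_right_0 DERIV_continuous_on[of _ f1 g]) (use df1 in auto)
  then have "(deriv f \<longlongrightarrow> f1 0) (at_right 0)"
    by (rule Lim_transform_eventually) (use ev d1 in \<open>auto elim!: eventually_mono\<close>)
  then show "right_deriv_0 f = f1 0"
    unfolding right_deriv_0_def by (intro tendsto_Lim) auto
  have "(g \<longlongrightarrow> g 0) (at_right 0)"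
    by (rule continuous_on_at_right_0[OF cg])
  then have "(deriv (deriv f) \<longlongrightarrow> g 0) (at_right 0)"
    by (rule Lim_transform_eventually) (use ev d2 in \<open>auto elim!: eventually_mono\<close>)
  then show "right_deriv2_0 f = g 0"
    unfolding right_deriv2_0_def by (intro tendsto_Lim) auto
qed

lemma continuous_Rplus_antiderivative:
  fixes g :: "real \<Rightarrow> real"
  assumes "continuous_on {0..} g"
  obtains G where "\<And>x. 0 \<le> x \<Longrightarrow> (G has_real_derivative g x) (at x within {0..})"
proof -
  have "((\<lambda>x. integral {0..x} g) has_real_derivative g x) (at x within {0..})" if x: "0 \<le> x" for x
  proof -
    have "at x within {0..} = at x within {0..x + 1}"
      by (rule at_within_nhd[of x "{..<x + 1}"]) auto
    then show ?thesis
      using integral_has_real_derivative[of 0 "x + 1" g x] x continuous_on_subset[OF assms, of "{0..x + 1}"]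
      by auto
  qed
  then show thesis by (rule that)
qed

lemma eq_derivative_Rplus:
  fixes f F F' :: "real \<Rightarrow> real"
  assumes "\<And>x. 0 < x \<Longrightarrow> (f has_real_derivative F' x) (at x)"
    and "\<And>x. 0 < x \<Longrightarrow> (F has_real_derivative F' x) (at x)"
  obtains c where "\<And>x. 0 < x \<Longrightarrow> f x = F x + c"
proof -
  have "\<exists>c. \<forall>x\<in>{0<..}. f x - F x = c"
  proof (rule has_field_derivative_zero_constant)
    fix x :: real assume "x \<in> {0<..}"
    then show "((\<lambda>x. f x - F x) has_real_derivative 0) (at x within {0<..})"
      using DERIV_diff[OF assms(1)[of x] assms(2)[of x]]
      by (simp add: has_field_derivative_at_within)
  qed simp
  then show thesis using that by (force simp: algebra_simps)
qed

text \<open>\<open>C02_Rplus\<close> speaks of derivatives on the open half-line only. Integrating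
  the extension \<open>g\<close> twice gives functions that also have one-sided derivatives at 0.
  They agree with \<open>deriv f\<close> and \<open>f\<close> up to constants on the open half-line,
  and continuity of \<open>f\<close> carries the second agreement to 0. The boundary condition thus
  becomes one between values at 0, where the Taylor formula is applied too.\<close>

lemma C02_smooth_rep:
  assumes "f \<in> C02_Rplus"
  obtains f1 g where "smooth_rep f f1 g"
proof -
  from assms obtain g where f: "f \<in> C0_Rplus" and g: "g \<in> C0_Rplus"
    and diff: "f differentiable_on {0<..}" "deriv f differentiable_on {0<..}"
    and gd: "\<And>x. 0 < x \<Longrightarrow> deriv (deriv f) x = g x"
    unfolding C02_Rplus_def by blast
  have at: "at x within {0..} = at x" if "0 < x" for x :: real
    using that by (intro at_within_interior) (simp add: interior_real_atLeast)
  have df: "(f has_real_derivative deriv f x) (at x)" if "0 < x" for x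
    using diff(1) that differentiable_on_eq_differentiable_at[of "{0<..}" f]
    by (simp add: DERIV_deriv_iff_real_differentiable)
  have ddf: "(deriv f has_real_derivative g x) (at x)" if "0 < x" for x
    using diff(2) that differentiable_on_eq_differentiable_at[of "{0<..}" "deriv f"] gd[OF that]
    by (metis DERIV_deriv_iff_real_differentiable greaterThan_iff open_greaterThan)
  have cf: "continuous_on {0..} f" and cg: "continuous_on {0..} g"
    using f g by (auto simp: C0_Rplus_def)
  obtain F1 where F1: "\<And>x. 0 \<le> x \<Longrightarrow> (F1 has_real_derivative g x) (at x within {0..})"
    using continuous_Rplus_antiderivative[OF cg] by blast
  obtain c where c: "\<And>x. 0 < x \<Longrightarrow> deriv f x = F1 x + c"
  proof (rule eq_derivative_Rplus[of "deriv f" g F1])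
    fix x :: real assume x: "0 < x"
    show "(deriv f has_real_derivative g x) (at x)" by (rule ddf[OF x])
    show "(F1 has_real_derivative g x) (at x)" using F1[of x] at[OF x] x by simp
  qed blast
  define f1 where "f1 x = F1 x + c" for x
  have df1: "(f1 has_real_derivative g x) (at x within {0..})" if "0 \<le> x" for x
    unfolding f1_def using F1[OF that] by (auto intro!: derivative_eq_intros)
  have "continuous_on {0..} f1"
    by (rule DERIV_continuous_on[of _ f1 g]) (use df1 in auto)
  then obtain F where F: "\<And>x. 0 \<le> x \<Longrightarrow> (F has_real_derivative f1 x) (at x within {0..})"
    using continuous_Rplus_antiderivative by blast
  obtain c' where c': "\<And>x. 0 < x \<Longrightarrow> f x = F x + c'"
  proof (rule eq_derivative_Rplus[of f f1 F])
    fix x :: real assume x: "0 < x"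
    show "(f has_real_derivative f1 x) (at x)" using df[OF x] c[OF x] by (simp add: f1_def)
    show "(F has_real_derivative f1 x) (at x)" using F[of x] at[OF x] x by simp
  qed blast
  have cF: "continuous_on {0..} F"
    by (rule DERIV_continuous_on[of _ F f1]) (use F in auto)
  have "(f \<longlongrightarrow> f 0) (at_right 0)"
    by (rule continuous_on_at_right_0[OF cf])
  moreover have "((\<lambda>x. F x + c') \<longlongrightarrow> F 0 + c') (at_right 0)"
    by (intro tendsto_intros continuous_on_at_right_0 cF)
  then have "(f \<longlongrightarrow> F 0 + c') (at_right 0)"
    by (rule Lim_transform_eventually)
       (use eventually_at_right_less[of 0] c' in \<open>auto elim!: eventually_mono\<close>)
  ultimately have "f 0 = F 0 + c'"
    by (rule tendsto_unique[rotated]) simp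
  then have eq: "f x = F x + c'" if "0 \<le> x" for x
    using that c'[of x] by (cases "x = 0") auto
  have "(f has_real_derivative f1 x) (at x within {0..})" if "0 \<le> x" for x
  proof (rule has_field_derivative_transform_within[where d = 1 and f = "\<lambda>x. F x + c'"])
    show "((\<lambda>x. F x + c') has_real_derivative f1 x) (at x within {0..})"
      using F[OF that] by (auto intro!: derivative_eq_intros)
  qed (use that eq in auto)
  then have "smooth_rep f f1 g"
    using f g df1 by (auto simp: smooth_rep_def)
  then show thesis by (rule that)
qed

text \<open>\<psi> is the factor of the mean local time in the small time expansion. The boundary
  condition says exactly that it vanishes at 0; the linear growth comes from x g(x).\<close>

lemma boundary_deficit:
  assumes rep: "smooth_rep f f1 g" and bc: "\<gamma> / 2 * g 0 = f1 0" and "\<gamma> > 0"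
  defines "\<psi> \<equiv> \<lambda>x. f1 x - \<gamma> / 2 * g x - x * g x"
  shows "\<exists>C>0. \<forall>x\<ge>0. \<bar>\<psi> x\<bar> \<le> C * (1 + x)"
    and "e > 0 \<Longrightarrow> \<exists>d>0. \<forall>x. 0 \<le> x \<and> x < d \<longrightarrow> \<bar>\<psi> x\<bar> < e"
proof -
  have g: "g \<in> C0_Rplus" using rep by (auto simp: smooth_rep_def)
  obtain C1 where C1: "C1 > 0" "\<And>x. 0 \<le> x \<Longrightarrow> \<bar>f1 x\<bar> \<le> C1"
    using smooth_rep_bounded_deriv[OF rep] by blast
  obtain C where C: "C > 0" "\<And>x. 0 \<le> x \<Longrightarrow> \<bar>g x\<bar> \<le> C"
    using C0_Rplus_bounded[OF g] by blast
  have "\<bar>\<psi> x\<bar> \<le> (C1 + \<gamma> / 2 * C + C) * (1 + x)" if x: "0 \<le> x" for x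
  proof -
    have "\<bar>\<psi> x\<bar> \<le> \<bar>f1 x\<bar> + \<gamma> / 2 * \<bar>g x\<bar> + x * \<bar>g x\<bar>"
      unfolding \<psi>_def using x \<open>\<gamma> > 0\<close> abs_mult[of "\<gamma> / 2" "g x"] abs_mult[of x "g x"]
      by auto
    also have "\<dots> \<le> C1 + \<gamma> / 2 * C + x * C"
      using C1(2)[OF x] C(2)[OF x] x \<open>\<gamma> > 0\<close> by (intro add_mono mult_left_mono) auto
    also have "\<dots> \<le> (C1 + \<gamma> / 2 * C + C) * (1 + x)"
      using C1(1) C(1) x \<open>\<gamma> > 0\<close> by (simp add: distrib_left distrib_right)
    finally show ?thesis .
  qed
  moreover have "C1 + \<gamma> / 2 * C + C > 0" using C1(1) C(1) \<open>\<gamma> > 0\<close> by (simp add: add_pos_pos)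
  ultimately show "\<exists>C>0. \<forall>x\<ge>0. \<bar>\<psi> x\<bar> \<le> C * (1 + x)" by blast
  have cf1: "continuous_on {0..} f1"
    by (rule DERIV_continuous_on[of _ f1 g]) (use rep in \<open>auto simp: smooth_rep_def\<close>)
  have cg: "continuous_on {0..} g" using g by (simp add: C0_Rplus_def)
  have "continuous_on {0..} \<psi>"
    unfolding \<psi>_def by (intro continuous_intros cf1 cg)
  have "\<psi> 0 = 0" using bc by (simp add: \<psi>_def)
  show "\<exists>d>0. \<forall>x. 0 \<le> x \<and> x < d \<longrightarrow> \<bar>\<psi> x\<bar> < e" if e: "e > 0"
  proof -
    obtain d where "d > 0" "\<And>x. x \<in> {0..} \<Longrightarrow> dist x 0 < d \<Longrightarrow> dist (\<psi> x) (\<psi> 0) < e"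
      using continuous_on_iff[THEN iffD1, OF \<open>continuous_on {0..} \<psi>\<close>, rule_format, of 0 e] e
      by auto
    then show ?thesis
      using \<open>\<psi> 0 = 0\<close> by (intro exI[of _ d]) (force simp: dist_real_def)
  qed
qed

section \<open>The resolvent equation h - h'' = k on the half-line\<close>

lemma exp_antiderivative_increment:
  fixes G k :: "real \<Rightarrow> real"
  assumes G: "\<And>x. 0 \<le> x \<Longrightarrow> (G has_real_derivative exp (- x) * k x) (at x within {0..})"
    and xy: "0 \<le> x" "x \<le> y" and k: "\<And>z. x \<le> z \<Longrightarrow> \<bar>k z\<bar> \<le> \<epsilon>"
  shows "\<bar>G y - G x\<bar> \<le> \<epsilon> * exp (- x)"
proof -
  have \<epsilon>: "0 \<le> \<epsilon>" using k[of x] by simp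
  have cont: "continuous_on {x..y} G"
    by (rule continuous_on_subset[OF DERIV_continuous_on[of "{0..}" G]]) (use G xy in auto)
  have der: "(G has_real_derivative exp (- z) * k z) (at z)" if "x < z" for z
    using G[of z] that xy at_within_interior[of z "{0..}"] by (simp add: interior_real_atLeast)
  \<comment> \<open>Adding - \<epsilon> exp(- z) makes both G and - G nondecreasing, which bounds
    the increment by \<epsilon> (exp(- x) - exp(- y)) in both directions.\<close>
  have step: "s * G x - \<epsilon> * exp (- x) \<le> s * G y - \<epsilon> * exp (- y)" if s: "s = 1 \<or> s = -1" for s
  proof (rule DERIV_nonneg_imp_increasing_open[where f = "\<lambda>z. s * G z - \<epsilon> * exp (- z)"])
    fix z assume z: "x < z" "z < y"
    have "((\<lambda>z. s * G z - \<epsilon> * exp (- z)) has_real_derivative exp (- z) * (s * k z + \<epsilon>)) (at z)"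
      by (rule derivative_eq_intros der z refl | simp add: algebra_simps)+
    moreover have "0 \<le> exp (- z) * (s * k z + \<epsilon>)"
      using k[of z] z s by (auto simp: abs_le_iff)
    ultimately show "\<exists>d. ((\<lambda>z. s * G z - \<epsilon> * exp (- z)) has_real_derivative d) (at z) \<and> 0 \<le> d"
      by blast
  qed (use xy in \<open>auto intro!: continuous_intros cont\<close>)
  have "0 \<le> \<epsilon> * exp (- y)" using \<epsilon> by simp
  then show ?thesis using step[of 1] step[of "-1"] by (simp add: abs_le_iff)
qed

text \<open>The solution vanishing at infinity comes from variation of constants; the multiple of \<open>exp (- x)\<close>
  that can be added to it is fixed by the boundary condition.\<close>

lemma resolvent_equation:
  assumes k: "k \<in> C0_Rplus" and "\<gamma> > 0"
  obtains h h1 where "smooth_rep h h1 (\<lambda>x. h x - k x)" "\<gamma> / 2 * (h 0 - k 0) = h1 0"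
proof -
  have ck: "continuous_on {0..} k" and limk: "(k \<longlongrightarrow> 0) at_top"
    using k by (auto simp: C0_Rplus_def)
  obtain K where K: "K > 0" "\<And>x. 0 \<le> x \<Longrightarrow> \<bar>k x\<bar> \<le> K"
    using C0_Rplus_bounded[OF k] by blast
  have at: "at x within {0..} = at x" if "0 < x" for x :: real
    using that by (intro at_within_interior) (simp add: interior_real_atLeast)
  have "continuous_on {0..} (\<lambda>x. exp x * k x)" by (intro continuous_intros ck)
  then obtain G1 where
    G1: "\<And>x. 0 \<le> x \<Longrightarrow> (G1 has_real_derivative exp x * k x) (at x within {0..})"
    using continuous_Rplus_antiderivative by blast
  have "continuous_on {0..} (\<lambda>x. exp (- x) * k x)" by (intro continuous_intros ck)
  then obtain G2 where
    G2: "\<And>x. 0 \<le> x \<Longrightarrow> (G2 has_real_derivative exp (- x) * k x) (at x within {0..})"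
    using continuous_Rplus_antiderivative by blast
  note incr = exp_antiderivative_increment[OF G2]
  have "Cauchy (\<lambda>n. G2 (real n))"
  proof (rule metric_CauchyI)
    fix e :: real assume e: "e > 0"
    have "((\<lambda>n. K * exp (- real n)) \<longlongrightarrow> 0) sequentially" by real_asymp
    then have "\<forall>\<^sub>F n in sequentially. K * exp (- real n) < e"
      by (rule order_tendstoD) (use e in simp)
    then obtain N where N: "K * exp (- real N) < e"
      by (auto simp: eventually_sequentially)
    have *: "dist (G2 (real m)) (G2 (real n)) < e" if "N \<le> m" "m \<le> n" for m n
    proof -
      have "\<bar>G2 (real n) - G2 (real m)\<bar> \<le> K * exp (- real m)"
        by (rule incr) (use that K in auto)
      also have "\<dots> \<le> K * exp (- real N)" using K that by simp
      finally show ?thesis using N by (simp add: dist_real_def abs_minus_commute)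
    qed
    show "\<exists>M. \<forall>m\<ge>M. \<forall>n\<ge>M. dist (G2 (real m)) (G2 (real n)) < e"
    proof (intro exI[of _ N] allI impI)
      fix m n assume "m \<ge> N" "n \<ge> N"
      then show "dist (G2 (real m)) (G2 (real n)) < e"
        using *[of m n] *[of n m] by (cases m n rule: le_cases) (auto simp: dist_commute)
    qed
  qed
  \<comment> \<open>\<open>J\<close> is the value of \<open>G2\<close> at infinity, so
    \<open>J - G2 x\<close> is the integral of exp(- z) k(z) over z > x.\<close>
  then obtain J where J: "(\<lambda>n. G2 (real n)) \<longlonglongrightarrow> J"
    by (auto simp: Cauchy_convergent_iff convergent_def)
  have tail: "\<bar>J - G2 x\<bar> \<le> \<epsilon> * exp (- x)" if "0 \<le> x" "\<And>z. x \<le> z \<Longrightarrow> \<bar>k z\<bar> \<le> \<epsilon>" for x \<epsilon>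
  proof (rule tendsto_upperbound)
    show "(\<lambda>n. \<bar>G2 (real n) - G2 x\<bar>) \<longlonglongrightarrow> \<bar>J - G2 x\<bar>" by (intro tendsto_intros J)
    show "\<forall>\<^sub>F n in sequentially. \<bar>G2 (real n) - G2 x\<bar> \<le> \<epsilon> * exp (- x)"
      using eventually_ge_at_top[of "nat \<lceil>x\<rceil>"]
    proof eventually_elim
      case (elim n)
      then have "x \<le> real n" by linarith
      then show ?case using that by (intro incr) auto
    qed
  qed simp
  \<comment> \<open>\<open>b x\<close> is half the integral of exp(x - y) k(y) over y > x. Up to a
    multiple of exp(- x), as \<open>G1\<close> is an arbitrary antiderivative, \<open>a x\<close> is
    half the integral of exp(y - x) k(y) over 0 < y < x. Hence a' = k/2 - a and b' = b - k/2, so a +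
    b solves h'' = h - k.\<close>
  define a where "a x = exp (- x) * G1 x / 2" for x
  define b where "b x = exp x * (J - G2 x) / 2" for x
  \<comment> \<open>The boundary condition solved for the coefficient of exp(- x), which enters
    \<open>h 0\<close> as + c and \<open>h1 0\<close> as - c.\<close>
  define c where "c = (b 0 - a 0 - \<gamma> / 2 * (a 0 + b 0 - k 0)) / (1 + \<gamma> / 2)"
  define h where "h x = a x + b x + c * exp (- x)" for x
  define h1 where "h1 x = b x - a x - c * exp (- x)" for x
  have da: "(a has_real_derivative k x / 2 - a x) (at x within {0..})" if "0 \<le> x" for x
  proof -
    have "exp (- x) * (exp x * k x) = k x" by (simp add: exp_minus)
    then show ?thesis
      unfolding a_def by (auto intro!: derivative_eq_intros G1 that simp: algebra_simps diff_divide_distrib)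
  qed
  have db: "(b has_real_derivative b x - k x / 2) (at x within {0..})" if "0 \<le> x" for x
  proof -
    have "exp x * (exp (- x) * k x) = k x" by (simp add: exp_minus)
    then show ?thesis
      unfolding b_def by (auto intro!: derivative_eq_intros G2 that simp: algebra_simps diff_divide_distrib)
  qed
  have dh: "(h has_real_derivative h1 x) (at x within {0..})" if "0 \<le> x" for x
    unfolding h_def h1_def by (rule derivative_eq_intros da db that refl | simp)+
  have dh1: "(h1 has_real_derivative h x - k x) (at x within {0..})" if "0 \<le> x" for x
    unfolding h_def h1_def by (rule derivative_eq_intros da db that refl | simp)+
  \<comment> \<open>This form of l'Hospital's rule asks only the denominator to tend to infinity;
    the quotient of the derivatives is \<open>k\<close>.\<close>
  have "((\<lambda>x. G1 x / exp x) \<longlongrightarrow> 0) at_top"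
  proof (rule lhospital_at_top_at_top[where f' = "\<lambda>x. exp x * k x" and g' = exp])
    show "\<forall>\<^sub>F x in at_top. (G1 has_real_derivative exp x * k x) (at x)"
      using eventually_gt_at_top[of 0]
    proof eventually_elim
      case (elim x)
      then show ?case using G1[of x] at[of x] by simp
    qed
    show "LIM x at_top. exp x :> (at_top :: real filter)" by (rule exp_at_top)
  qed (use limk in \<open>auto intro!: derivative_eq_intros always_eventually\<close>)
  then have lima: "(a \<longlongrightarrow> 0) at_top"
    unfolding a_def exp_minus by (auto simp: field_simps dest: tendsto_divide[OF _ tendsto_const[of 2]])
  have limb: "(b \<longlongrightarrow> 0) at_top"
  proof (rule tendstoI)
    fix e :: real assume e: "e > 0"
    have "\<forall>\<^sub>F x in at_top. dist (k x) 0 < e" by (rule tendstoD[OF limk e])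
    then obtain N where N: "\<And>x. x \<ge> N \<Longrightarrow> \<bar>k x\<bar> < e"
      by (auto simp: eventually_at_top_linorder dist_real_def)
    show "\<forall>\<^sub>F x in at_top. dist (b x) 0 < e"
      using eventually_ge_at_top[of "max 0 N"]
    proof eventually_elim
      case (elim x)
      have "\<bar>J - G2 x\<bar> \<le> e * exp (- x)"
        by (rule tail) (use elim N in \<open>auto intro: less_imp_le\<close>)
      then have "exp x * \<bar>J - G2 x\<bar> \<le> exp x * (e * exp (- x))" by simp
      also have "\<dots> = e" by (simp add: exp_minus)
      finally show ?case using e by (simp add: b_def dist_real_def abs_mult)
    qed
  qed
  have "((\<lambda>x. c * exp (- x)) \<longlongrightarrow> 0) at_top" by real_asymp
  from tendsto_add[OF tendsto_add[OF lima limb] this]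
  have "(h \<longlongrightarrow> 0) at_top" unfolding h_def by simp
  moreover have "continuous_on {0..} h"
    by (rule DERIV_continuous_on[of _ h h1]) (use dh in auto)
  ultimately have h: "h \<in> C0_Rplus" by (simp add: C0_Rplus_def)
  have "(\<lambda>x. h x - k x) \<in> C0_Rplus"
    using h k tendsto_diff[of h 0 at_top k 0] by (auto simp: C0_Rplus_def intro!: continuous_intros)
  then have "smooth_rep h h1 (\<lambda>x. h x - k x)"
    using h dh dh1 by (simp add: smooth_rep_def)
  moreover have "\<gamma> / 2 * (h 0 - k 0) = h1 0"
  proof -
    have "c * (1 + \<gamma> / 2) = b 0 - a 0 - \<gamma> / 2 * (a 0 + b 0 - k 0)"
      unfolding c_def using \<open>\<gamma> > 0\<close> by (simp add: field_simps)
    then show ?thesis unfolding h_def h1_def by (simp add: algebra_simps)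
  qed
  ultimately show thesis by (rule that)
qed

section \<open>Moments of Brownian increments\<close>

context brownian_family
begin

lemma space_P: "space (P x) = space M"
  using sets_eq_imp_space_eq[OF sets_P] .

lemma space_F: "0 \<le> t \<Longrightarrow> space (F t) = space M"
  using subalgebra_F[of t] by (simp add: subalgebra_def)

lemma borel_measurable_F_mono:
  fixes Z :: "'a \<Rightarrow> real"
  assumes "Z \<in> borel_measurable (F s)" "0 \<le> s" "s \<le> t"
  shows "Z \<in> borel_measurable (F t)"
proof (rule measurable_from_subalg[OF _ assms(1)])
  have "sets (F s) \<subseteq> sets (F t)"
    using filtration.sets_F_mono[OF filtration_F, of s t] assms by simp
  then show "subalgebra (F t) (F s)"
    using assms by (simp add: subalgebra_def space_F)
qed

lemma borel_measurable_F_P: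
  fixes Z :: "'a \<Rightarrow> real"
  assumes "Z \<in> borel_measurable (F s)" "0 \<le> s"
  shows "Z \<in> borel_measurable (P x)"
proof -
  have "Z \<in> borel_measurable M"
    by (rule measurable_from_subalg[OF subalgebra_F assms(1)]) (rule assms)
  then show ?thesis using measurable_cong_sets[OF sets_P[of x] refl] by blast
qed

lemma B_measurable_F: "0 \<le> s \<Longrightarrow> s \<le> t \<Longrightarrow> B s \<in> borel_measurable (F t)"
  by (rule borel_measurable_F_mono[OF adapted_B])

lemma B_measurable_P [measurable]: "0 \<le> s \<Longrightarrow> B s \<in> borel_measurable (P x)"
  by (rule borel_measurable_F_P[OF adapted_B])

lemma sets_F_P: "A \<in> sets (F s) \<Longrightarrow> 0 \<le> s \<Longrightarrow> A \<in> sets (P x)"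
  using subalgebra_F[of s] sets_P[of x] by (auto simp: subalgebra_def)

text \<open>The \<sigma>-algebra generated by \<open>Z\<close> lies inside \<open>F s\<close>, so
  independence of \<sigma>-algebras passes to the two random variables, for which the product
  formula for expectations is available.\<close>

lemma indep_var_increment:
  fixes Z :: "'a \<Rightarrow> real"
  assumes Z: "Z \<in> borel_measurable (F s)" and st: "0 \<le> s" "s < t"
  shows "prob_space.indep_var (P x) borel Z borel (\<lambda>\<omega>. B t \<omega> - B s \<omega>)"
proof -
  interpret prob_space "P x" by (rule prob_space_P)
  let ?D = "\<lambda>\<omega>. B t \<omega> - B s \<omega>"
  let ?V = "vimage_algebra (space M) ?D borel"
  have "sigma_sets (space (P x)) {Z -` A \<inter> space (P x) |A. A \<in> sets borel} \<subseteq> sets (F s)"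
    using measurable_sets[OF Z] st
    by (simp add: space_P flip: space_F[of s]) (auto intro!: sets.sigma_sets_subset)
  moreover have "sigma_sets (space (P x)) {?D -` A \<inter> space (P x) |A. A \<in> sets borel} \<subseteq> sets ?V"
    by (simp add: space_P sets_vimage_algebra)
  ultimately have "indep_set (sigma_sets (space (P x)) {Z -` A \<inter> space (P x) |A. A \<in> sets borel})
    (sigma_sets (space (P x)) {?D -` A \<inter> space (P x) |A. A \<in> sets borel})"
    using indep_increments_B[OF st, of x] unfolding indep_set_def
    by (rule_tac indep_sets_mono_sets) (auto split: bool.split)
  moreover have "Z \<in> borel_measurable (P x)" "?D \<in> borel_measurable (P x)"
    using borel_measurable_F_P[OF Z] st by (auto intro!: borel_measurable_diff B_measurable_P)
  ultimately show ?thesis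
    unfolding indep_var_eq by blast
qed

text \<open>The normal density is given for s < t only, so the degenerate increment s = t is treated
  apart.\<close>

lemma increment_moment:
  assumes "0 \<le> s" "s \<le> t"
  shows "integrable (P x) (\<lambda>\<omega>. (B t \<omega> - B s \<omega>) ^ k)"
    and "odd k \<Longrightarrow> (\<integral>\<omega>. (B t \<omega> - B s \<omega>) ^ k \<partial>P x) = 0"
    and "(\<integral>\<omega>. (B t \<omega> - B s \<omega>)\<^sup>2 \<partial>P x) = t - s"
    and "(\<integral>\<omega>. (B t \<omega> - B s \<omega>) ^ 4 \<partial>P x) = 3 * (t - s)\<^sup>2"
proof -
  interpret prob_space "P x" by (rule prob_space_P)
  note D = normal_increments_B[OF \<open>0 \<le> s\<close>, of t x]
  have eq: "(\<integral>\<omega>. (B t \<omega> - B s \<omega>) ^ j \<partial>P x) =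
      (\<integral>y. normal_density 0 (sqrt (t - s)) y * (y - 0) ^ j \<partial>lborel)" if "s < t" for j
    using distributed_integral[OF D[OF that], of "\<lambda>y. y ^ j"] by simp
  show "integrable (P x) (\<lambda>\<omega>. (B t \<omega> - B s \<omega>) ^ k)"
  proof (cases "s = t")
    case True then show ?thesis by simp
  next
    case False
    then have st: "s < t" using assms by simp
    from integrable_normal_moment[of "sqrt (t - s)" 0 k] st
    have "integrable lborel (\<lambda>y. normal_density 0 (sqrt (t - s)) y * y ^ k)" by simp
    then show ?thesis
      using distributed_integrable[OF D[OF st], of "\<lambda>y. y ^ k"] by simp
  qed
  show "(\<integral>\<omega>. (B t \<omega> - B s \<omega>) ^ k \<partial>P x) = 0" if k: "odd k"
  proof (cases "s = t")
    case True then show ?thesis using k by (simp add: odd_pos)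
  next
    case False
    then have st: "s < t" using assms by simp
    from k obtain j where "k = 2 * j + 1" by (rule oddE)
    then show ?thesis
      using eq[OF st, of k] integral_normal_moment_odd[of "sqrt (t - s)" 0 j] st by simp
  qed
  show "(\<integral>\<omega>. (B t \<omega> - B s \<omega>)\<^sup>2 \<partial>P x) = t - s"
  proof (cases "s = t")
    case False
    then have st: "s < t" using assms by simp
    then show ?thesis
      using eq[OF st, of 2] integral_normal_moment_even[of "sqrt (t - s)" 0 1] by simp
  qed simp
  show "(\<integral>\<omega>. (B t \<omega> - B s \<omega>) ^ 4 \<partial>P x) = 3 * (t - s)\<^sup>2"
  proof (cases "s = t")
    case False
    then have st: "s < t" using assms by simp
    then show ?thesis
      using eq[OF st, of 4] integral_normal_moment_even[of "sqrt (t - s)" 0 2]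
      by (simp add: fact_numeral power2_eq_square field_simps)
  qed simp
qed

text \<open>With the exponent left open, one product formula covers the martingale property (k = 1),
  the isometry (k = 2) and the expansion of the fourth moment (up to k = 4).\<close>

lemma increment_expectation:
  fixes Z :: "'a \<Rightarrow> real"
  assumes Z: "Z \<in> borel_measurable (F s)" "integrable (P x) Z" and st: "0 \<le> s" "s \<le> t"
  shows "integrable (P x) (\<lambda>\<omega>. Z \<omega> * (B t \<omega> - B s \<omega>) ^ k)"
    and "(\<integral>\<omega>. Z \<omega> * (B t \<omega> - B s \<omega>) ^ k \<partial>P x) =
      (\<integral>\<omega>. Z \<omega> \<partial>P x) * (\<integral>\<omega>. (B t \<omega> - B s \<omega>) ^ k \<partial>P x)"
proof -
  interpret prob_space "P x" by (rule prob_space_P)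
  have "integrable (P x) (\<lambda>\<omega>. Z \<omega> * (B t \<omega> - B s \<omega>) ^ k) \<and>
    (\<integral>\<omega>. Z \<omega> * (B t \<omega> - B s \<omega>) ^ k \<partial>P x) =
      (\<integral>\<omega>. Z \<omega> \<partial>P x) * (\<integral>\<omega>. (B t \<omega> - B s \<omega>) ^ k \<partial>P x)"
  proof (cases "s = t")
    case True
    then show ?thesis using Z prob_space by (cases "k = 0") auto
  next
    case False
    then have "s < t" using st by simp
    from indep_var_compose[OF indep_var_increment[OF Z(1) st(1) this, of x],
        of "\<lambda>z. z" borel "\<lambda>d. d ^ k" borel]
    have ind: "indep_var borel Z borel (\<lambda>\<omega>. (B t \<omega> - B s \<omega>) ^ k)" by (simp add: comp_def)
    show ?thesis
      using indep_var_lebesgue_integral[OF ind Z(2) increment_moment(1)[OF st]]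
        indep_var_integrable[OF ind Z(2) increment_moment(1)[OF st]] by simp
  qed
  then show "integrable (P x) (\<lambda>\<omega>. Z \<omega> * (B t \<omega> - B s \<omega>) ^ k)"
    and "(\<integral>\<omega>. Z \<omega> * (B t \<omega> - B s \<omega>) ^ k \<partial>P x) =
      (\<integral>\<omega>. Z \<omega> \<partial>P x) * (\<integral>\<omega>. (B t \<omega> - B s \<omega>) ^ k \<partial>P x)" by auto
qed

end

section \<open>Ito isometry and martingale property\<close>

lemma integrable_bounded_mult:
  fixes X Z :: "'a \<Rightarrow> real"
  assumes "integrable Q X" "Z \<in> borel_measurable Q" "\<And>\<omega>. \<omega> \<in> space Q \<Longrightarrow> \<bar>Z \<omega>\<bar> \<le> C"
  shows "integrable Q (\<lambda>\<omega>. Z \<omega> * X \<omega>)"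
proof (rule Bochner_Integration.integrable_bound[of _ "\<lambda>\<omega>. C * X \<omega>"])
  show "AE \<omega> in Q. norm (Z \<omega> * X \<omega>) \<le> norm (C * X \<omega>)"
    using assms(3) by (intro AE_I2) (force simp: abs_mult intro!: mult_right_mono)
qed (use assms in auto)

context brownian_family
begin

definition bounded_var :: "('a \<Rightarrow> real) \<Rightarrow> bool" where
  "bounded_var Z \<longleftrightarrow> (\<exists>C. \<forall>\<omega>\<in>space M. \<bar>Z \<omega>\<bar> \<le> C)"

lemma bounded_var_mult: "bounded_var Y \<Longrightarrow> bounded_var Z \<Longrightarrow> bounded_var (\<lambda>\<omega>. Y \<omega> * Z \<omega>)"
proof -
  assume "bounded_var Y" "bounded_var Z"
  then obtain C D where C: "\<And>\<omega>. \<omega> \<in> space M \<Longrightarrow> \<bar>Y \<omega>\<bar> \<le> C"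
    and D: "\<And>\<omega>. \<omega> \<in> space M \<Longrightarrow> \<bar>Z \<omega>\<bar> \<le> D"
    unfolding bounded_var_def by blast
  have "\<bar>Y \<omega> * Z \<omega>\<bar> \<le> C * D" if "\<omega> \<in> space M" for \<omega>
    using mult_mono[OF C[OF that] D[OF that]] C[OF that] by (simp add: abs_mult)
  then show ?thesis unfolding bounded_var_def by blast
qed

lemma bounded_var_indicator: "bounded_var (indicator A)"
  unfolding bounded_var_def by (rule exI[of _ 1]) (simp add: indicator_def)

lemma integrable_bounded_var_mult:
  assumes "bounded_var Z" "Z \<in> borel_measurable (F s)" "0 \<le> s" "integrable (P x) X"
  shows "integrable (P x) (\<lambda>\<omega>. Z \<omega> * X \<omega>)"
  using assms integrable_bounded_mult[OF assms(4) borel_measurable_F_P[OF assms(2,3)]]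
  by (auto simp: bounded_var_def space_P)

lemma integrable_bounded_var:
  assumes "bounded_var Z" "Z \<in> borel_measurable (F s)" "0 \<le> s"
  shows "integrable (P x) Z"
proof -
  interpret prob_space "P x" by (rule prob_space_P)
  show ?thesis using integrable_bounded_var_mult[OF assms, of x "\<lambda>_. 1"] by simp
qed

lemma martingale_increment:
  assumes "Z \<in> borel_measurable (F s)" "integrable (P x) Z" "0 \<le> s" "s \<le> t"
  shows "integrable (P x) (\<lambda>\<omega>. Z \<omega> * (B t \<omega> - B s \<omega>))"
    and "(\<integral>\<omega>. Z \<omega> * (B t \<omega> - B s \<omega>) \<partial>P x) = 0"
  using increment_expectation[OF assms, of 1] increment_moment(2)[OF assms(3,4), of 1 x] by simp_all

text \<open>For c \<le> p \<le> q the longer increment is the shorter one plus B q - B p: the square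
  contributes p - c, and the rest pairs to 0 with everything known at time p.\<close>

lemma product_increments:
  assumes Z: "Z \<in> borel_measurable (F c)" "bounded_var Z" and c: "0 \<le> c" "c \<le> p" "c \<le> q"
  shows "integrable (P x) (\<lambda>\<omega>. Z \<omega> * ((B p \<omega> - B c \<omega>) * (B q \<omega> - B c \<omega>))) \<and>
    (\<integral>\<omega>. Z \<omega> * ((B p \<omega> - B c \<omega>) * (B q \<omega> - B c \<omega>)) \<partial>P x) = (\<integral>\<omega>. Z \<omega> \<partial>P x) * (min p q - c)"
proof -
  have iZ: "integrable (P x) Z" by (rule integrable_bounded_var[OF Z(2,1) c(1)])
  have ordered: "integrable (P x) (\<lambda>\<omega>. Z \<omega> * ((B p \<omega> - B c \<omega>) * (B q \<omega> - B c \<omega>))) \<and>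
    (\<integral>\<omega>. Z \<omega> * ((B p \<omega> - B c \<omega>) * (B q \<omega> - B c \<omega>)) \<partial>P x) = (\<integral>\<omega>. Z \<omega> \<partial>P x) * (p - c)"
    if pq: "c \<le> p" "p \<le> q" for p q
  proof -
    have m: "(\<lambda>\<omega>. Z \<omega> * (B p \<omega> - B c \<omega>)) \<in> borel_measurable (F p)"
      using borel_measurable_F_mono[OF Z(1), of p] B_measurable_F[of p p] B_measurable_F[of c p] c pq
      by auto
    have eq: "Z \<omega> * ((B p \<omega> - B c \<omega>) * (B q \<omega> - B c \<omega>)) =
        Z \<omega> * (B p \<omega> - B c \<omega>)\<^sup>2 + Z \<omega> * (B p \<omega> - B c \<omega>) * (B q \<omega> - B p \<omega>)" for \<omega>
      by (simp add: power2_eq_square algebra_simps)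
    note i1 = increment_expectation[OF Z(1) iZ c(1) pq(1), of 2]
    note i2 = martingale_increment[OF m martingale_increment(1)[OF Z(1) iZ c(1) pq(1)] _ pq(2)]
    show ?thesis
      unfolding eq using i1 i2 increment_moment(3)[OF c(1) pq(1), of x] c pq by simp
  qed
  show ?thesis
    using ordered[of p q] ordered[of q p] c by (cases "p \<le> q") (auto simp: mult.commute min_def)
qed

text \<open>The length of the intersection of (a, b] and (c, d].\<close>

definition overlap :: "real \<Rightarrow> real \<Rightarrow> real \<Rightarrow> real \<Rightarrow> real" where
  "overlap a b c d = max 0 (min b d - max a c)"

text \<open>By symmetry \<open>a \<le> c\<close>, and the product of the coefficients is then known
  at time \<open>c\<close>. The part of the first increment before \<open>c\<close> pairs to 0 with
  the second increment, which lies in its future; the part after \<open>c\<close> falls under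
  \<open>product_increments\<close>.\<close>

lemma ito_isometry_pair:
  assumes \<eta>: "\<eta> \<in> borel_measurable (F a)" "bounded_var \<eta>" and ab: "0 \<le> a" "a \<le> b"
    and \<eta>': "\<eta>' \<in> borel_measurable (F c)" "bounded_var \<eta>'" and cd: "0 \<le> c" "c \<le> d"
  shows "has_bochner_integral (P x)
    (\<lambda>\<omega>. (\<eta> \<omega> * (B b \<omega> - B a \<omega>)) * (\<eta>' \<omega> * (B d \<omega> - B c \<omega>)))
    ((\<integral>\<omega>. \<eta> \<omega> * \<eta>' \<omega> \<partial>P x) * overlap a b c d)"
proof -
  have ordered: "has_bochner_integral (P x)
    (\<lambda>\<omega>. (\<eta> \<omega> * (B b \<omega> - B a \<omega>)) * (\<eta>' \<omega> * (B d \<omega> - B c \<omega>)))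
    ((\<integral>\<omega>. \<eta> \<omega> * \<eta>' \<omega> \<partial>P x) * overlap a b c d)"
    if \<eta>: "\<eta> \<in> borel_measurable (F a)" "bounded_var \<eta>" and ab: "0 \<le> a" "a \<le> b"
      and \<eta>': "\<eta>' \<in> borel_measurable (F c)" "bounded_var \<eta>'" and cd: "0 \<le> c" "c \<le> d"
      and ac: "a \<le> c" for a b c d \<eta> \<eta>'
  proof -
    define Z where "Z \<omega> = \<eta> \<omega> * \<eta>' \<omega>" for \<omega>
    have mZ: "Z \<in> borel_measurable (F c)"
      unfolding Z_def using borel_measurable_F_mono[OF \<eta>(1) ab(1) ac] \<eta>'(1) by measurable
    have bZ: "bounded_var Z" unfolding Z_def by (rule bounded_var_mult[OF \<eta>(2) \<eta>'(2)])
    \<comment> \<open>Used with \<open>p = b\<close> when the first step ends by time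
      \<open>c\<close>, and with \<open>p = c\<close> otherwise.\<close>
    have past: "integrable (P x) (\<lambda>\<omega>. Z \<omega> * (B p \<omega> - B a \<omega>) * (B d \<omega> - B c \<omega>)) \<and>
        (\<integral>\<omega>. Z \<omega> * (B p \<omega> - B a \<omega>) * (B d \<omega> - B c \<omega>) \<partial>P x) = 0" if p: "a \<le> p" "p \<le> c" for p
    proof -
      have "(\<lambda>\<omega>. Z \<omega> * (B p \<omega> - B a \<omega>)) \<in> borel_measurable (F c)"
        using mZ B_measurable_F[of p c] B_measurable_F[of a c] p ab by auto
      moreover have "integrable (P x) (\<lambda>\<omega>. Z \<omega> * (B p \<omega> - B a \<omega>))"
        using integrable_bounded_var_mult[OF bZ mZ cd(1) increment_moment(1)[OF ab(1) p(1), of x 1]]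
        by simp
      ultimately show ?thesis
        using martingale_increment cd by blast
    qed
    show ?thesis
    proof (cases "b \<le> c")
      case True
      then show ?thesis using past[OF ab(2) True]
        by (simp add: has_bochner_integral_iff overlap_def Z_def mult_ac)
    next
      case False
      have eq: "(\<eta> \<omega> * (B b \<omega> - B a \<omega>)) * (\<eta>' \<omega> * (B d \<omega> - B c \<omega>)) =
          Z \<omega> * (B c \<omega> - B a \<omega>) * (B d \<omega> - B c \<omega>) +
          Z \<omega> * ((B b \<omega> - B c \<omega>) * (B d \<omega> - B c \<omega>))" for \<omega>
        unfolding Z_def by (simp add: algebra_simps)
      show ?thesis
        using past[OF ac order_refl] product_increments[OF mZ bZ cd(1) _ cd(2), of b x] False cd ac
        unfolding has_bochner_integral_iff eq by (auto simp: overlap_def Z_def max_def)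
    qed
  qed
  show ?thesis
  proof (cases "a \<le> c")
    case True
    then show ?thesis by (rule ordered[OF assms])
  next
    case False
    then show ?thesis
      using ordered[OF \<eta>' cd \<eta> ab] by (simp add: overlap_def mult.commute min.commute max.commute)
  qed
qed

lemma overlap_indicator:
  "has_bochner_integral lborel (\<lambda>s. indicator {a<..b} s * indicator {c<..d} s :: real) (overlap a b c d)"
proof -
  have "(\<lambda>s. indicator {a<..b} s * indicator {c<..d} s :: real) = indicator {max a c<..min b d}"
    by (auto simp: indicator_def fun_eq_iff)
  moreover have "measure lborel {max a c<..min b d} = overlap a b c d"
    by (cases "max a c \<le> min b d") (simp_all add: overlap_def del: max.bounded_iff min.bounded_iff)
  moreover have "emeasure lborel {max a c<..min b d} < \<infinity>"
    by (cases "max a c \<le> min b d") (simp_all del: max.bounded_iff min.bounded_iff)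
  ultimately show ?thesis
    using has_bochner_integral_real_indicator[of "{max a c<..min b d}" lborel] by simp
qed

text \<open>Both sides expand into the same double sum over pairs of steps. The index set is any
  finite one and steps may overlap, so integrands over different partitions can be subtracted
  without a common refinement.\<close>

lemma ito_isometry_steps:
  fixes a b :: "'i \<Rightarrow> real" and \<eta> :: "'i \<Rightarrow> 'a \<Rightarrow> real"
  assumes J: "finite J"
    and steps: "\<And>i. i \<in> J \<Longrightarrow> 0 \<le> a i \<and> a i \<le> b i \<and> \<eta> i \<in> borel_measurable (F (a i)) \<and> bounded_var (\<eta> i)"
  defines "S \<equiv> \<lambda>\<omega>. \<Sum>i\<in>J. \<eta> i \<omega> * (B (b i) \<omega> - B (a i) \<omega>)"
  shows "integrable (P x) (\<lambda>\<omega>. (S \<omega>)\<^sup>2)"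
    and "(\<integral>\<^sup>+\<omega>. ennreal ((S \<omega>)\<^sup>2) \<partial>P x) =
      (\<integral>\<^sup>+\<omega>. (\<integral>\<^sup>+s. ennreal ((\<Sum>i\<in>J. \<eta> i \<omega> * indicator {a i<..b i} s)\<^sup>2) \<partial>lborel) \<partial>P x)"
proof -
  define V where "V \<omega> = (\<Sum>i\<in>J. \<Sum>j\<in>J. (\<eta> i \<omega> * \<eta> j \<omega>) * overlap (a i) (b i) (a j) (b j))" for \<omega>
  have S2: "has_bochner_integral (P x) (\<lambda>\<omega>. (S \<omega>)\<^sup>2)
    (\<Sum>i\<in>J. \<Sum>j\<in>J. (\<integral>\<omega>. \<eta> i \<omega> * \<eta> j \<omega> \<partial>P x) * overlap (a i) (b i) (a j) (b j))"
    unfolding S_def power2_eq_square sum_product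
    by (intro has_bochner_integral_sum ito_isometry_pair) (use steps in auto)
  then show "integrable (P x) (\<lambda>\<omega>. (S \<omega>)\<^sup>2)" by (simp add: has_bochner_integral_iff)
  have iV: "integrable (P x) (\<lambda>\<omega>. \<eta> i \<omega> * \<eta> j \<omega>)" if "i \<in> J" "j \<in> J" for i j
    using steps[OF that(1)] steps[OF that(2)] by (auto intro: integrable_bounded_var_mult integrable_bounded_var)
  have V: "has_bochner_integral (P x) V
    (\<Sum>i\<in>J. \<Sum>j\<in>J. (\<integral>\<omega>. \<eta> i \<omega> * \<eta> j \<omega> \<partial>P x) * overlap (a i) (b i) (a j) (b j))"
    unfolding V_def
    by (intro has_bochner_integral_sum has_bochner_integral_mult_left has_bochner_integral_integrable iV)
  have inner: "has_bochner_integral lborel (\<lambda>s. (\<Sum>i\<in>J. \<eta> i \<omega> * indicator {a i<..b i} s)\<^sup>2) (V \<omega>)" for \<omega>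
  proof -
    have "(\<lambda>s. (\<Sum>i\<in>J. \<eta> i \<omega> * indicator {a i<..b i} s)\<^sup>2) =
      (\<lambda>s. \<Sum>i\<in>J. \<Sum>j\<in>J. (\<eta> i \<omega> * \<eta> j \<omega>) * (indicator {a i<..b i} s * indicator {a j<..b j} s))"
      unfolding power2_eq_square sum_product by (simp add: mult_ac)
    then show ?thesis
      unfolding V_def
      by (auto intro!: has_bochner_integral_sum has_bochner_integral_mult_right overlap_indicator)
  qed
  have V0: "0 \<le> V \<omega>" for \<omega>
    by (subst has_bochner_integral_integral_eq[OF inner[of \<omega>], symmetric])
       (rule Bochner_Integration.integral_nonneg, simp)
  have "(\<integral>\<^sup>+s. ennreal ((\<Sum>i\<in>J. \<eta> i \<omega> * indicator {a i<..b i} s)\<^sup>2) \<partial>lborel) = ennreal (V \<omega>)" for \<omega>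
    using inner[of \<omega>] by (subst nn_integral_eq_integral) (auto simp: has_bochner_integral_iff)
  then show "(\<integral>\<^sup>+\<omega>. ennreal ((S \<omega>)\<^sup>2) \<partial>P x) =
      (\<integral>\<^sup>+\<omega>. (\<integral>\<^sup>+s. ennreal ((\<Sum>i\<in>J. \<eta> i \<omega> * indicator {a i<..b i} s)\<^sup>2) \<partial>lborel) \<partial>P x)"
    using S2 V V0 by (simp add: nn_integral_eq_integral has_bochner_integral_iff)
qed

end

lemma (in prob_space) square_expectation_le:
  fixes Y :: "'a \<Rightarrow> real"
  assumes Y: "integrable M Y"
  shows "ennreal ((expectation Y)\<^sup>2) \<le> (\<integral>\<^sup>+\<omega>. ennreal ((Y \<omega>)\<^sup>2) \<partial>M)"
proof (cases "(\<integral>\<^sup>+\<omega>. ennreal ((Y \<omega>)\<^sup>2) \<partial>M) = \<infinity>")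
  case False
  then have Y2: "integrable M (\<lambda>\<omega>. (Y \<omega>)\<^sup>2)"
    using Y by (intro integrableI_nonneg) (auto simp: top.not_eq_extremum)
  have "0 \<le> expectation (\<lambda>\<omega>. (Y \<omega>)\<^sup>2) - (expectation Y)\<^sup>2"
    using variance_eq[OF Y Y2] variance_positive[of Y] by simp
  then show ?thesis
    using Y2 by (simp add: nn_integral_eq_integral ennreal_leI)
qed simp

lemma integrable_from_square:
  fixes Y :: "'a \<Rightarrow> real"
  assumes "finite_measure Q" "Y \<in> borel_measurable Q" "(\<integral>\<^sup>+\<omega>. ennreal ((Y \<omega>)\<^sup>2) \<partial>Q) < \<infinity>"
  shows "integrable Q Y"
proof -
  interpret finite_measure Q by fact
  have "integrable Q (\<lambda>\<omega>. (Y \<omega>)\<^sup>2)"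
    by (rule integrableI_nonneg) (use assms(2,3) in simp_all)
  with assms(2) show ?thesis by (rule square_integrable_imp_integrable)
qed

section \<open>Elementary stochastic integrals\<close>

context brownian_family
begin

lemma elementary_integrandD:
  assumes "elementary_integrand F (n, u, \<xi>)"
  shows "i \<le> n \<Longrightarrow> 0 \<le> u i"
    and "i < n \<Longrightarrow> u i \<le> u (Suc i)"
    and "i < n \<Longrightarrow> \<xi> i \<in> borel_measurable (F (u i))"
    and "i < n \<Longrightarrow> bounded_var (\<xi> i)"
proof -
  note E = assms[unfolded elementary_integrand.simps]
  note Ei = mp[OF spec[OF conjunct2[OF E]]]
  \<comment> \<open>Only \<open>u 0\<close> is assumed nonnegative. The rest follows along the
    partition and identifies the space of \<open>F (u i)\<close> with that of
    \<open>M\<close>.\<close>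
  have nonneg: "0 \<le> u i" if "i \<le> n" for i
    using that
  proof (induction i)
    case 0 then show ?case using E by (rule_tac conjunct1)
  next
    case (Suc i) then show ?case using conjunct1[OF Ei[of i]] by simp
  qed
  show "i \<le> n \<Longrightarrow> 0 \<le> u i" by (rule nonneg)
  assume i: "i < n"
  show "u i \<le> u (Suc i)" by (rule conjunct1[OF Ei[OF i]])
  show "\<xi> i \<in> borel_measurable (F (u i))" by (rule conjunct1[OF conjunct2[OF Ei[OF i]]])
  show "bounded_var (\<xi> i)"
    using conjunct2[OF conjunct2[OF Ei[OF i]]] nonneg[of i] i
    by (simp only: bounded_var_def space_F less_imp_le)
qed

lemma elementary_integral_measurable:
  assumes "elementary_integrand F E" "0 \<le> T"
  shows "elementary_integral B E T \<in> borel_measurable (P x)"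
proof -
  obtain n u \<xi> where E: "E = (n, u, \<xi>)" by (cases E)
  note u = elementary_integrandD[OF assms(1)[unfolded E]]
  have [measurable]: "\<xi> i \<in> borel_measurable (P x)" if "i < n" for i
    by (rule borel_measurable_F_P[OF u(3) u(1)]) (use that in auto)
  have [measurable]: "B (min T (u i)) \<in> borel_measurable (P x)" if "i \<le> n" for i
    by (rule B_measurable_P) (use u(1)[OF that] assms(2) in simp)
  have "(\<lambda>\<omega>. \<Sum>i<n. \<xi> i \<omega> * (B (min T (u (Suc i))) \<omega> - B (min T (u i)) \<omega>)) \<in> borel_measurable (P x)"
    by measurable
  then show ?thesis unfolding E elementary_integral.simps[abs_def] .
qed

lemma elementary_process_measurable:
  assumes "elementary_integrand F E"
  shows "(\<lambda>(\<omega>, s). elementary_process E s \<omega>) \<in> borel_measurable (P x \<Otimes>\<^sub>M lborel)"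
proof -
  obtain n u \<xi> where E: "E = (n, u, \<xi>)" by (cases E)
  note u = elementary_integrandD[OF assms(1)[unfolded E]]
  have [measurable]: "\<xi> i \<in> borel_measurable (P x)" if "i < n" for i
    by (rule borel_measurable_F_P[OF u(3) u(1)]) (use that in auto)
  have "(\<lambda>(\<omega>, s). \<Sum>i<n. \<xi> i \<omega> * indicator {u i<..u (Suc i)} s) \<in> borel_measurable (P x \<Otimes>\<^sub>M lborel)"
    by measurable
  then show ?thesis unfolding E elementary_process.simps .
qed

text \<open>Coefficients of steps that begin after \<open>T\<close> are replaced by \<open>0\<close>, since they need not be
  measurable with respect to \<open>F T\<close>.\<close>

lemma elementary_steps:
  assumes E: "elementary_integrand F E" and T: "0 \<le> T"
  obtains n :: nat and a b \<eta> where
    "\<And>i. i < n \<Longrightarrow> 0 \<le> a i \<and> a i \<le> b i \<and> \<eta> i \<in> borel_measurable (F (a i)) \<and> bounded_var (\<eta> i)"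
    "\<And>\<omega>. elementary_integral B E T \<omega> = (\<Sum>i<n. \<eta> i \<omega> * (B (b i) \<omega> - B (a i) \<omega>))"
    "\<And>s \<omega>. elementary_process E s \<omega> * indicator {0..T} s = (\<Sum>i<n. \<eta> i \<omega> * indicator {a i<..b i} s)"
proof -
  obtain n u \<xi> where E_eq: "E = (n, u, \<xi>)" by (cases E)
  note u = elementary_integrandD[OF E[unfolded E_eq]]
  define \<eta> where "\<eta> i = (if u i \<le> T then \<xi> i else (\<lambda>_. 0))" for i
  show thesis
  proof (rule that[of n "\<lambda>i. min T (u i)" "\<lambda>i. min T (u (Suc i))" \<eta>])
    fix i assume "i < n"
    then show "0 \<le> min T (u i) \<and> min T (u i) \<le> min T (u (Suc i)) \<and>
        \<eta> i \<in> borel_measurable (F (min T (u i))) \<and> bounded_var (\<eta> i)"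
      using u[of i] T by (auto simp: \<eta>_def bounded_var_def min_def)
  next
    fix \<omega>
    show "elementary_integral B E T \<omega> =
        (\<Sum>i<n. \<eta> i \<omega> * (B (min T (u (Suc i))) \<omega> - B (min T (u i)) \<omega>))"
      unfolding E_eq elementary_integral.simps
    proof (rule sum.cong)
      fix i assume "i \<in> {..<n}"
      then show "\<xi> i \<omega> * (B (min T (u (Suc i))) \<omega> - B (min T (u i)) \<omega>) =
          \<eta> i \<omega> * (B (min T (u (Suc i))) \<omega> - B (min T (u i)) \<omega>)"
        using u(2)[of i] by (simp add: \<eta>_def min_def)
    qed simp
  next
    fix s \<omega>
    show "elementary_process E s \<omega> * indicator {0..T} s =
        (\<Sum>i<n. \<eta> i \<omega> * indicator {min T (u i)<..min T (u (Suc i))} s)"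
      unfolding E_eq elementary_process.simps sum_distrib_right
    proof (rule sum.cong)
      fix i assume "i \<in> {..<n}"
      then show "\<xi> i \<omega> * indicator {u i<..u (Suc i)} s * indicator {0..T} s =
          \<eta> i \<omega> * indicator {min T (u i)<..min T (u (Suc i))} s"
        using u(1)[of i] u(2)[of i] T by (auto simp: \<eta>_def indicator_def min_def)
    qed simp
  qed
qed

lemma elementary_integral_square_integrable:
  assumes "elementary_integrand F E" "0 \<le> T"
  shows "integrable (P x) (\<lambda>\<omega>. (elementary_integral B E T \<omega>)\<^sup>2)"
proof -
  obtain n a b \<eta> where steps:
    "\<And>i. i < n \<Longrightarrow> 0 \<le> a i \<and> a i \<le> b i \<and> \<eta> i \<in> borel_measurable (F (a i)) \<and> bounded_var (\<eta> i)"
    and eq: "\<And>\<omega>. elementary_integral B E T \<omega> = (\<Sum>i<(n::nat). \<eta> i \<omega> * (B (b i) \<omega> - B (a i) \<omega>))"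
    by (rule elementary_steps[OF assms]) blast
  show ?thesis unfolding eq
    by (rule ito_isometry_steps(1)) (use steps in auto)
qed

lemma elementary_integral_integrable:
  assumes "elementary_integrand F E" "0 \<le> T"
  shows "integrable (P x) (elementary_integral B E T)"
proof -
  interpret prob_space "P x" by (rule prob_space_P)
  show ?thesis
    using elementary_integral_measurable[OF assms] elementary_integral_square_integrable[OF assms]
    by (rule square_integrable_imp_integrable)
qed

text \<open>The steps of \<open>E\<close> and the negated steps of \<open>E'\<close> form one finite
  family over a disjoint sum of index sets, to which the isometry for overlapping steps
  applies.\<close>

lemma ito_isometry_diff:
  assumes E: "elementary_integrand F E" and E': "elementary_integrand F E'" and T: "0 \<le> T"
  shows "(\<integral>\<^sup>+\<omega>. ennreal ((elementary_integral B E T \<omega> - elementary_integral B E' T \<omega>)\<^sup>2) \<partial>P x) =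
    (\<integral>\<^sup>+\<omega>. (\<integral>\<^sup>+s\<in>{0..T}. ennreal ((elementary_process E s \<omega> - elementary_process E' s \<omega>)\<^sup>2) \<partial>lborel) \<partial>P x)"
proof -
  obtain n a b \<eta> where steps:
    "\<And>i. i < n \<Longrightarrow> 0 \<le> a i \<and> a i \<le> b i \<and> \<eta> i \<in> borel_measurable (F (a i)) \<and> bounded_var (\<eta> i)"
    and int: "\<And>\<omega>. elementary_integral B E T \<omega> = (\<Sum>i<(n::nat). \<eta> i \<omega> * (B (b i) \<omega> - B (a i) \<omega>))"
    and proc: "\<And>s \<omega>. elementary_process E s \<omega> * indicator {0..T} s = (\<Sum>i<n. \<eta> i \<omega> * indicator {a i<..b i} s)"
    by (rule elementary_steps[OF E T]) blast
  obtain n' a' b' \<eta>' where steps':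
    "\<And>i. i < n' \<Longrightarrow> 0 \<le> a' i \<and> a' i \<le> b' i \<and> \<eta>' i \<in> borel_measurable (F (a' i)) \<and> bounded_var (\<eta>' i)"
    and int': "\<And>\<omega>. elementary_integral B E' T \<omega> = (\<Sum>i<(n'::nat). \<eta>' i \<omega> * (B (b' i) \<omega> - B (a' i) \<omega>))"
    and proc': "\<And>s \<omega>. elementary_process E' s \<omega> * indicator {0..T} s = (\<Sum>i<n'. \<eta>' i \<omega> * indicator {a' i<..b' i} s)"
    by (rule elementary_steps[OF E' T]) blast
  let ?J = "{..<n} <+> {..<n'}"
  let ?a = "case_sum a a'" and ?b = "case_sum b b'" and ?\<eta> = "case_sum \<eta> (\<lambda>i \<omega>. - \<eta>' i \<omega>)"
  have bdd: "bounded_var (\<lambda>\<omega>. - Z \<omega>) \<longleftrightarrow> bounded_var Z" for Z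
    by (simp add: bounded_var_def)
  have diff: "elementary_integral B E T \<omega> - elementary_integral B E' T \<omega> =
      (\<Sum>i\<in>?J. ?\<eta> i \<omega> * (B (?b i) \<omega> - B (?a i) \<omega>))" for \<omega>
    unfolding int int' by (subst sum.Plus) (simp_all add: sum_negf)
  have proc_diff: "(elementary_process E s \<omega> - elementary_process E' s \<omega>) * indicator {0..T} s =
      (\<Sum>i\<in>?J. ?\<eta> i \<omega> * indicator {?a i<..?b i} s)" for s \<omega>
    unfolding left_diff_distrib proc proc' by (subst sum.Plus) (simp_all add: sum_negf)
  have "ennreal ((elementary_process E s \<omega> - elementary_process E' s \<omega>)\<^sup>2) * indicator {0..T} s =
      ennreal ((\<Sum>i\<in>?J. ?\<eta> i \<omega> * indicator {?a i<..?b i} s)\<^sup>2)" for s \<omega>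
    unfolding proc_diff[symmetric] by (cases "s \<in> {0..T}") simp_all
  moreover have "0 \<le> ?a i \<and> ?a i \<le> ?b i \<and> ?\<eta> i \<in> borel_measurable (F (?a i)) \<and> bounded_var (?\<eta> i)"
    if "i \<in> ?J" for i
    using that by (elim PlusE) (simp_all add: bdd steps steps')
  ultimately show ?thesis
    unfolding diff using ito_isometry_steps(2)[of ?J ?a ?b ?\<eta> x] by simp
qed

text \<open>Between \<open>s\<close> and \<open>t\<close> each summand changes by a coefficient
  known at time \<open>r = max s (u i)\<close> times an increment of \<open>B\<close> that starts at
  \<open>r\<close>.\<close>

lemma elementary_integral_martingale:
  assumes E: "elementary_integrand F E" and A: "A \<in> sets (F s)" and st: "0 \<le> s" "s \<le> t"
  shows "(\<integral>\<omega>. indicator A \<omega> * (elementary_integral B E t \<omega> - elementary_integral B E s \<omega>) \<partial>P x) = 0"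
proof -
  obtain n u \<xi> where E_eq: "E = (n, u, \<xi>)" by (cases E)
  note u = elementary_integrandD[OF E[unfolded E_eq]]
  have "has_bochner_integral (P x) (\<lambda>\<omega>. indicator A \<omega> *
      (\<xi> i \<omega> * (B (min t (u (Suc i))) \<omega> - B (min t (u i)) \<omega>) -
       \<xi> i \<omega> * (B (min s (u (Suc i))) \<omega> - B (min s (u i)) \<omega>))) 0" if i: "i < n" for i
  proof -
    have u: "0 \<le> u i" "u i \<le> u (Suc i)" "\<xi> i \<in> borel_measurable (F (u i))" "bounded_var (\<xi> i)"
      using u[of i] i by simp_all
    define r where "r = max s (u i)"
    define Z where "Z \<omega> = indicator A \<omega> * \<xi> i \<omega>" for \<omega>
    have r: "0 \<le> r" "s \<le> r" "u i \<le> r" using st u by (auto simp: r_def)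
    have "indicator A \<in> borel_measurable (F s)" using A by simp
    from borel_measurable_F_mono[OF this st(1) r(2)] borel_measurable_F_mono[OF u(3,1) r(3)]
    have mZ: "Z \<in> borel_measurable (F r)" unfolding Z_def by measurable
    have bZ: "bounded_var Z" unfolding Z_def by (intro bounded_var_mult bounded_var_indicator u)
    \<comment> \<open>The end of the active part of the step; \<open>q = r\<close> if the step does
      not meet (s, t].\<close>
    define q where "q = max r (min t (u (Suc i)))"
    have "has_bochner_integral (P x) (\<lambda>\<omega>. Z \<omega> * (B q \<omega> - B r \<omega>)) 0"
      using martingale_increment[OF mZ integrable_bounded_var[OF bZ mZ r(1)] r(1), of q]
      by (simp add: q_def has_bochner_integral_iff)
    moreover have "indicator A \<omega> *
      (\<xi> i \<omega> * (B (min t (u (Suc i))) \<omega> - B (min t (u i)) \<omega>) -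
       \<xi> i \<omega> * (B (min s (u (Suc i))) \<omega> - B (min s (u i)) \<omega>)) = Z \<omega> * (B q \<omega> - B r \<omega>)" for \<omega>
    proof -
      consider "u (Suc i) \<le> s" | "u i \<le> s" "s \<le> u (Suc i)" | "s \<le> u i" "u i \<le> t" | "s \<le> u i" "t \<le> u i"
        by linarith
      then show ?thesis
        using st u(2) unfolding q_def r_def Z_def
        by cases (simp_all add: min_absorb1 min_absorb2 max_absorb1 max_absorb2 algebra_simps)
    qed
    ultimately show ?thesis by simp
  qed
  from has_bochner_integral_sum[of "{..<n}", OF this]
  have "has_bochner_integral (P x) (\<lambda>\<omega>. \<Sum>i<n. indicator A \<omega> *
      (\<xi> i \<omega> * (B (min t (u (Suc i))) \<omega> - B (min t (u i)) \<omega>) -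
       \<xi> i \<omega> * (B (min s (u (Suc i))) \<omega> - B (min s (u i)) \<omega>))) 0"
    by simp
  then show ?thesis
    unfolding E_eq elementary_integral.simps sum_subtractf[symmetric] sum_distrib_left
    by (rule has_bochner_integral_integral_eq)
qed

end

lemma square_diff_le: "ennreal ((a - b)\<^sup>2) \<le> 2 * ennreal ((h - a)\<^sup>2) + 2 * ennreal ((h - b)\<^sup>2)"
proof -
  have "(a - b)\<^sup>2 \<le> 2 * (h - a)\<^sup>2 + 2 * (h - b)\<^sup>2"
    using sum_squares_ge_zero[of "h - a + (h - b)" 0] by (simp add: power2_eq_square algebra_simps)
  then have "ennreal ((a - b)\<^sup>2) \<le> ennreal (2 * (h - a)\<^sup>2 + 2 * (h - b)\<^sup>2)" by (rule ennreal_leI)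
  then show ?thesis by (simp add: ennreal_mult)
qed

lemma square_sum3_le:
  "ennreal ((a + b + c)\<^sup>2) \<le> 3 * ennreal (a\<^sup>2) + 3 * ennreal (b\<^sup>2) + 3 * ennreal (c\<^sup>2)"
proof -
  have "(a + b + c)\<^sup>2 \<le> 3 * a\<^sup>2 + 3 * b\<^sup>2 + 3 * c\<^sup>2"
    using sum_squares_ge_zero[of "a - b" "b - c"] zero_le_power2[of "a - c"]
    by (simp add: power2_eq_square algebra_simps)
  then have "ennreal ((a + b + c)\<^sup>2) \<le> ennreal (3 * a\<^sup>2 + 3 * b\<^sup>2 + 3 * c\<^sup>2)" by (rule ennreal_leI)
  then show ?thesis by (simp add: ennreal_mult)
qed

section \<open>Passage from elementary integrands to the Ito integral\<close>

context brownian_family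
begin

text \<open>The squared L^2 distance with respect to time on [0, T] and \<open>P x\<close>, the
  first of the two quantities that \<open>is_ito_integral\<close> sends to 0.\<close>

definition elementary_error :: "real \<Rightarrow> (real \<Rightarrow> 'a \<Rightarrow> real) \<Rightarrow> real \<Rightarrow> 'a elementary \<Rightarrow> ennreal" where
  "elementary_error x H T E =
    (\<integral>\<^sup>+\<omega>. (\<integral>\<^sup>+s\<in>{0..T}. ennreal ((H s \<omega> - elementary_process E s \<omega>)\<^sup>2) \<partial>lborel) \<partial>P x)"

lemma elementary_error_mono: "s \<le> t \<Longrightarrow> elementary_error x H s E \<le> elementary_error x H t E"
  unfolding elementary_error_def
  by (intro nn_integral_mono mult_left_mono) (auto simp: indicator_def)

text \<open>Joint measurability is given over [0, T] only; clamping time to this interval leaves the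
  integrand unchanged there and extends it to all of \<open>lborel\<close>. The factors are swapped
  to make the time integral the inner one.\<close>

lemma integrand_measurable:
  assumes "(\<lambda>(s, \<omega>). H s \<omega>) \<in> borel_measurable (restrict_space borel {0..T} \<Otimes>\<^sub>M F T)" "0 \<le> T"
  shows "(\<lambda>(\<omega>, s). H (max 0 (min T s)) \<omega>) \<in> borel_measurable (P x \<Otimes>\<^sub>M lborel)"
proof -
  have "(\<lambda>\<omega>. \<omega>) \<in> measurable (P x) (F T)"
    using assms(2) sets_F_P[of _ T x] sets.sets_into_space[of _ "F T"]
    by (intro measurableI) (auto simp: space_F space_P Int_absorb2)
  moreover have "(\<lambda>s. max 0 (min T s)) \<in> measurable lborel (restrict_space borel {0..T})"
    using assms(2) by (intro measurable_restrict_space2) auto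
  ultimately have "(\<lambda>(\<omega>, s). (max 0 (min T s), \<omega>)) \<in>
      measurable (P x \<Otimes>\<^sub>M lborel) (restrict_space borel {0..T} \<Otimes>\<^sub>M F T)"
    by measurable
  from measurable_compose[OF this assms(1)] show ?thesis
    by (simp add: case_prod_beta)
qed

lemma elementary_error_measurable:
  assumes H: "(\<lambda>(s, \<omega>). H s \<omega>) \<in> borel_measurable (restrict_space borel {0..T} \<Otimes>\<^sub>M F T)"
    and T: "0 \<le> T" and E: "elementary_integrand F E"
  shows "(\<lambda>(\<omega>, s). ennreal ((H s \<omega> - elementary_process E s \<omega>)\<^sup>2) * indicator {0..T} s)
    \<in> borel_measurable (P x \<Otimes>\<^sub>M lborel)"
proof -
  have "(\<lambda>z. ennreal (((\<lambda>(\<omega>, s). H (max 0 (min T s)) \<omega>) z - (\<lambda>(\<omega>, s). elementary_process E s \<omega>) z)\<^sup>2) *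
      indicator {0..T} (snd z)) \<in> borel_measurable (P x \<Otimes>\<^sub>M lborel)"
    using integrand_measurable[OF H T, of x] elementary_process_measurable[OF E, of x] by measurable
  moreover have "(\<lambda>z. ennreal (((\<lambda>(\<omega>, s). H (max 0 (min T s)) \<omega>) z - (\<lambda>(\<omega>, s). elementary_process E s \<omega>) z)\<^sup>2) *
      indicator {0..T} (snd z)) =
      (\<lambda>(\<omega>, s). ennreal ((H s \<omega> - elementary_process E s \<omega>)\<^sup>2) * indicator {0..T} s)"
    by (auto simp: fun_eq_iff indicator_def max_def min_def)
  ultimately show ?thesis by simp
qed

text \<open>The isometry turns the distance of the integrals into that of the integrands, and both
  integrands are compared with \<open>H\<close>.\<close>

lemma elementary_distance_le:
  assumes H: "(\<lambda>(s, \<omega>). H s \<omega>) \<in> borel_measurable (restrict_space borel {0..T} \<Otimes>\<^sub>M F T)"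
    and T: "0 \<le> T" and E: "elementary_integrand F E" and E': "elementary_integrand F E'"
  shows "(\<integral>\<^sup>+\<omega>. ennreal ((elementary_integral B E T \<omega> - elementary_integral B E' T \<omega>)\<^sup>2) \<partial>P x)
    \<le> 2 * elementary_error x H T E + 2 * elementary_error x H T E'"
proof -
  define e where "e E \<omega> s = ennreal ((H s \<omega> - elementary_process E s \<omega>)\<^sup>2) * indicator {0..T} s" for E \<omega> s
  have m: "case_prod (e E) \<in> borel_measurable (P x \<Otimes>\<^sub>M lborel)" if "elementary_integrand F E" for E
    unfolding e_def by (rule elementary_error_measurable[OF H T that])
  have m1: "(\<lambda>\<omega>. \<integral>\<^sup>+s. e E \<omega> s \<partial>lborel) \<in> borel_measurable (P x)" if "elementary_integrand F E" for E
    using lborel.borel_measurable_nn_integral[OF m[OF that]] .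
  have m2: "e E \<omega> \<in> borel_measurable lborel" if "elementary_integrand F E" "\<omega> \<in> space (P x)" for E \<omega>
    using measurable_Pair2[OF m[OF that(1)] that(2)] by simp
  have "(\<integral>\<^sup>+\<omega>. ennreal ((elementary_integral B E T \<omega> - elementary_integral B E' T \<omega>)\<^sup>2) \<partial>P x) =
    (\<integral>\<^sup>+\<omega>. (\<integral>\<^sup>+s\<in>{0..T}. ennreal ((elementary_process E s \<omega> - elementary_process E' s \<omega>)\<^sup>2) \<partial>lborel) \<partial>P x)"
    by (rule ito_isometry_diff[OF E E' T])
  also have "\<dots> \<le> (\<integral>\<^sup>+\<omega>. (\<integral>\<^sup>+s. 2 * e E \<omega> s + 2 * e E' \<omega> s \<partial>lborel) \<partial>P x)"
    unfolding e_def
    by (intro nn_integral_mono) (simp add: square_diff_le split: split_indicator)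
  also have "\<dots> = (\<integral>\<^sup>+\<omega>. 2 * (\<integral>\<^sup>+s. e E \<omega> s \<partial>lborel) + 2 * (\<integral>\<^sup>+s. e E' \<omega> s \<partial>lborel) \<partial>P x)"
    using m2[OF E] m2[OF E']
    by (intro nn_integral_cong) (simp add: nn_integral_add nn_integral_cmult)
  also have "\<dots> = 2 * elementary_error x H T E + 2 * elementary_error x H T E'"
    using m1[OF E] m1[OF E']
    by (simp add: nn_integral_add nn_integral_cmult elementary_error_def e_def)
  finally show ?thesis .
qed

text \<open>A single approximation with finite squared error suffices: \<open>I T\<close> is a
  square integrable difference plus an elementary integral.\<close>

lemma ito_integral_integrable:
  assumes "is_ito_integral (P x) F B H I" "0 \<le> T"
  shows "integrable (P x) (I T)"
proof -
  interpret prob_space "P x" by (rule prob_space_P)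
  from assms obtain E where I: "I T \<in> borel_measurable (F T)" and E: "\<And>k. elementary_integrand F (E k)"
    and lim: "(\<lambda>k. \<integral>\<^sup>+\<omega>. ennreal ((I T \<omega> - elementary_integral B (E k) T \<omega>)\<^sup>2) \<partial>P x) \<longlonglongrightarrow> 0"
    unfolding is_ito_integral_def by blast
  have "\<forall>\<^sub>F k in sequentially. (\<integral>\<^sup>+\<omega>. ennreal ((I T \<omega> - elementary_integral B (E k) T \<omega>)\<^sup>2) \<partial>P x) < 1"
    by (rule order_tendstoD(2)[OF lim]) simp
  then obtain k where k: "(\<integral>\<^sup>+\<omega>. ennreal ((I T \<omega> - elementary_integral B (E k) T \<omega>)\<^sup>2) \<partial>P x) < 1"
    unfolding eventually_sequentially by blast
  have "integrable (P x) (\<lambda>\<omega>. I T \<omega> - elementary_integral B (E k) T \<omega>)"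
  proof (rule integrable_from_square)
    show "(\<lambda>\<omega>. I T \<omega> - elementary_integral B (E k) T \<omega>) \<in> borel_measurable (P x)"
      using borel_measurable_F_P[OF I assms(2)] elementary_integral_measurable[OF E assms(2)]
      by (rule borel_measurable_diff)
    show "(\<integral>\<^sup>+\<omega>. ennreal ((I T \<omega> - elementary_integral B (E k) T \<omega>)\<^sup>2) \<partial>P x) < \<infinity>"
      by (rule less_trans[OF k]) simp
  qed (rule finite_measure_axioms)
  from Bochner_Integration.integrable_add[OF this elementary_integral_integrable[OF E[of k] assms(2)]]
  show ?thesis by simp
qed

text \<open>The integrals at \<open>s\<close> and \<open>t\<close> are given by unrelated sequences
  \<open>E'\<close> and \<open>E\<close>. The integral of \<open>E k\<close> up to \<open>s\<close>
  still approximates \<open>I s\<close>: its distance from that of \<open>E' k\<close> is controlled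
  by the errors of both on [0, s], and there the error of \<open>E k\<close> is at most its error on
  [0, t]. Since elementary integrals are martingales, subtracting the increment of one leaves the
  mean \<open>c\<close> unchanged.\<close>

lemma ito_integral_martingale:
  assumes ito: "is_ito_integral (P x) F B H I" and A: "A \<in> sets (F s)" and st: "0 \<le> s" "s \<le> t"
  shows "(\<integral>\<omega>. indicator A \<omega> * (I t \<omega> - I s \<omega>) \<partial>P x) = 0"
proof -
  interpret prob_space "P x" by (rule prob_space_P)
  let ?I = "elementary_integral B"
  have t: "0 \<le> t" using st by simp
  from ito st(1) obtain E' where Is: "I s \<in> borel_measurable (F s)"
    and H: "(\<lambda>(s, \<omega>). H s \<omega>) \<in> borel_measurable (restrict_space borel {0..s} \<Otimes>\<^sub>M F s)"
    and E': "\<And>k. elementary_integrand F (E' k)"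
    and err': "(\<lambda>k. elementary_error x H s (E' k)) \<longlonglongrightarrow> 0"
    and lim': "(\<lambda>k. \<integral>\<^sup>+\<omega>. ennreal ((I s \<omega> - ?I (E' k) s \<omega>)\<^sup>2) \<partial>P x) \<longlonglongrightarrow> 0"
    unfolding is_ito_integral_def elementary_error_def by blast
  from ito t obtain E where It: "I t \<in> borel_measurable (F t)"
    and E: "\<And>k. elementary_integrand F (E k)"
    and err: "(\<lambda>k. elementary_error x H t (E k)) \<longlonglongrightarrow> 0"
    and lim: "(\<lambda>k. \<integral>\<^sup>+\<omega>. ennreal ((I t \<omega> - ?I (E k) t \<omega>)\<^sup>2) \<partial>P x) \<longlonglongrightarrow> 0"
    unfolding is_ito_integral_def elementary_error_def by blast
  note [measurable] = borel_measurable_F_P[OF Is st(1)] borel_measurable_F_P[OF It t]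
    elementary_integral_measurable[OF E t] elementary_integral_measurable[OF E st(1)]
    elementary_integral_measurable[OF E' st(1)]
  have iA: "integrable (P x) (\<lambda>\<omega>. indicator A \<omega> * X \<omega>)" if "integrable (P x) X" for X :: "'a \<Rightarrow> real"
    using integrable_real_mult_indicator[OF sets_F_P[OF A st(1)] that] by (simp add: mult.commute)
  define c where "c = (\<integral>\<omega>. indicator A \<omega> * (I t \<omega> - I s \<omega>) \<partial>P x)"
  define D where "D k \<omega> = (I t \<omega> - I s \<omega>) - (?I (E k) t \<omega> - ?I (E k) s \<omega>)" for k \<omega>
  define R where "R k = 3 * (\<integral>\<^sup>+\<omega>. ennreal ((I t \<omega> - ?I (E k) t \<omega>)\<^sup>2) \<partial>P x) +
      3 * (\<integral>\<^sup>+\<omega>. ennreal ((I s \<omega> - ?I (E' k) s \<omega>)\<^sup>2) \<partial>P x) +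
      3 * (2 * elementary_error x H t (E k) + 2 * elementary_error x H s (E' k))" for k
  have iI: "integrable (P x) (I t)" "integrable (P x) (I s)"
    using ito_integral_integrable[OF ito] st t by auto
  note iE = elementary_integral_integrable[OF E t] elementary_integral_integrable[OF E st(1)]
  have "ennreal (c\<^sup>2) \<le> R k" for k
  proof -
    have "c = (\<integral>\<omega>. indicator A \<omega> * (I t \<omega> - I s \<omega>) -
        indicator A \<omega> * (?I (E k) t \<omega> - ?I (E k) s \<omega>) \<partial>P x)"
      using elementary_integral_martingale[OF E A st] iI iE
      by (simp add: c_def iA)
    also have "\<dots> = (\<integral>\<omega>. indicator A \<omega> * D k \<omega> \<partial>P x)"
      by (simp add: D_def algebra_simps)
    finally have c_eq: "c = (\<integral>\<omega>. indicator A \<omega> * D k \<omega> \<partial>P x)" .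
    have "integrable (P x) (D k)" unfolding D_def using iI iE by auto
    then have "ennreal (c\<^sup>2) \<le> (\<integral>\<^sup>+\<omega>. ennreal ((indicator A \<omega> * D k \<omega>)\<^sup>2) \<partial>P x)"
      unfolding c_eq by (intro square_expectation_le iA)
    also have "\<dots> \<le> (\<integral>\<^sup>+\<omega>. 3 * ennreal ((I t \<omega> - ?I (E k) t \<omega>)\<^sup>2) +
        3 * ennreal ((I s \<omega> - ?I (E' k) s \<omega>)\<^sup>2) + 3 * ennreal ((?I (E k) s \<omega> - ?I (E' k) s \<omega>)\<^sup>2) \<partial>P x)"
    proof (rule nn_integral_mono)
      fix \<omega>
      \<comment> \<open>Three errors: \<open>E k\<close> at time \<open>t\<close>,
        \<open>E' k\<close> at time \<open>s\<close>, and the mismatch of the two sequences at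
        \<open>s\<close>.\<close>
      have D: "D k \<omega> = (I t \<omega> - ?I (E k) t \<omega>) + (?I (E' k) s \<omega> - I s \<omega>) + (?I (E k) s \<omega> - ?I (E' k) s \<omega>)"
        by (simp add: D_def)
      have "ennreal ((indicator A \<omega> * D k \<omega>)\<^sup>2) \<le> ennreal ((D k \<omega>)\<^sup>2)"
        by (simp split: split_indicator)
      also have "\<dots> \<le> 3 * ennreal ((I t \<omega> - ?I (E k) t \<omega>)\<^sup>2) +
        3 * ennreal ((I s \<omega> - ?I (E' k) s \<omega>)\<^sup>2) + 3 * ennreal ((?I (E k) s \<omega> - ?I (E' k) s \<omega>)\<^sup>2)"
        unfolding D by (rule order_trans[OF square_sum3_le]) (simp add: power2_commute)
      finally show "ennreal ((indicator A \<omega> * D k \<omega>)\<^sup>2) \<le> 3 * ennreal ((I t \<omega> - ?I (E k) t \<omega>)\<^sup>2) +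
        3 * ennreal ((I s \<omega> - ?I (E' k) s \<omega>)\<^sup>2) + 3 * ennreal ((?I (E k) s \<omega> - ?I (E' k) s \<omega>)\<^sup>2)" .
    qed
    also have "\<dots> = 3 * (\<integral>\<^sup>+\<omega>. ennreal ((I t \<omega> - ?I (E k) t \<omega>)\<^sup>2) \<partial>P x) +
      3 * (\<integral>\<^sup>+\<omega>. ennreal ((I s \<omega> - ?I (E' k) s \<omega>)\<^sup>2) \<partial>P x) +
      3 * (\<integral>\<^sup>+\<omega>. ennreal ((?I (E k) s \<omega> - ?I (E' k) s \<omega>)\<^sup>2) \<partial>P x)"
      by (simp add: nn_integral_add nn_integral_cmult)
    also have "\<dots> \<le> R k"
      unfolding R_def
      by (intro add_mono mult_left_mono order_refl order_trans[OF elementary_distance_le[OF H st(1) E E']]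
          elementary_error_mono st) auto
    finally show ?thesis .
  qed
  moreover have "R \<longlonglongrightarrow> 3 * 0 + 3 * 0 + 3 * (2 * 0 + 2 * 0)"
    unfolding R_def
    by (intro tendsto_add ennreal_tendsto_cmult lim lim' err err') auto
  ultimately have "ennreal (c\<^sup>2) \<le> 0"
    by (intro LIMSEQ_le_const[of R]) auto
  then show ?thesis by (simp add: c_def)
qed

end

section \<open>Optional stopping on a grid\<close>

context brownian_local_time
begin

lemma AE_start: "AE \<omega> in P x. B 0 \<omega> = x"
proof -
  interpret prob_space "P x" by (rule prob_space_P)
  have [measurable]: "B 0 \<in> borel_measurable (P x)" by (rule B_measurable_P) simp
  have "prob {\<omega> \<in> space (P x). B 0 \<omega> = x} = 1" using start_B[of x] by (simp add: space_P)
  then show ?thesis by (subst (asm) prob_Collect_eq_1) auto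
qed

lemma B_integrable: "0 \<le> s \<Longrightarrow> integrable (P x) (B s)"
proof -
  assume s: "0 \<le> s"
  interpret prob_space "P x" by (rule prob_space_P)
  have "integrable (P x) (\<lambda>\<omega>. (B s \<omega> - B 0 \<omega>) + x)"
    using increment_moment(1)[of 0 s x 1] s by simp
  then show ?thesis
    by (rule integrable_cong_AE_imp) (use AE_start[of x] B_measurable_P[OF s] in auto)
qed

lemma L_integrable:
  assumes "0 \<le> s"
  shows "integrable (P x) (L s)"
proof -
  have "integrable (P x) (\<lambda>\<omega>. \<bar>B s \<omega>\<bar> - \<bar>B 0 \<omega>\<bar>)"
    by (intro Bochner_Integration.integrable_diff integrable_abs B_integrable assms order_refl)
  from Bochner_Integration.integrable_diff[OF this ito_integral_integrable[OF tanaka assms]]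
  show ?thesis by simp
qed

lemma L_nonneg: "\<omega> \<in> space M \<Longrightarrow> 0 \<le> s \<Longrightarrow> 0 \<le> L s \<omega>"
  using mono_onD[OF mono_L, of \<omega> 0 s] start_L by simp

end

text \<open>\<open>t\<close> is the time of the sticky process, and \<open>n\<close> the number of
  cells cutting [0, t] in Brownian time; the clock at \<open>t\<close> stays in this
  interval.\<close>

locale stopping_grid = brownian_local_time M P F B \<theta> L
  for M :: "'a measure" and P F :: "real \<Rightarrow> 'a measure" and B :: "real \<Rightarrow> 'a \<Rightarrow> real"
    and \<theta> :: "real \<Rightarrow> 'a \<Rightarrow> 'a" and L :: "real \<Rightarrow> 'a \<Rightarrow> real" +
  fixes \<gamma> t :: real and n :: nat
  assumes \<gamma>: "0 < \<gamma>" and t: "0 < t" and n: "0 < n"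
begin

definition h :: real where "h = t / real n"

text \<open>A discrete stopping time: the first grid index at which the additive functional reaches
  \<open>t\<close>. The index \<open>n\<close> always qualifies, as n h = t and \<open>L\<close> is
  nonnegative.\<close>

definition idx :: "'a \<Rightarrow> nat" where
  "idx \<omega> = (LEAST k. t \<le> real k * h + \<gamma> * L (real k * h) \<omega>)"

lemma h_pos: "0 < h" and h_le: "h \<le> t" and n_h: "real n * h = t"
  using t n by (auto simp: h_def field_simps)

lemma idx_le: "\<omega> \<in> space M \<Longrightarrow> idx \<omega> \<le> n"
  unfolding idx_def using L_nonneg[of \<omega> t] \<gamma> t by (intro Least_le) (simp add: n_h)

text \<open>Going on past \<open>k\<close> is decided by \<open>L\<close> at time k h alone, which
  makes it an event of the filtration at that time; by monotonicity of \<open>L\<close> the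
  threshold, once reached, stays reached.\<close>

lemma less_idx_iff:
  assumes "\<omega> \<in> space M"
  shows "k < idx \<omega> \<longleftrightarrow> real k * h + \<gamma> * L (real k * h) \<omega> < t"
proof
  assume "k < idx \<omega>"
  then show "real k * h + \<gamma> * L (real k * h) \<omega> < t"
    unfolding idx_def by (auto dest: not_less_Least)
next
  assume *: "real k * h + \<gamma> * L (real k * h) \<omega> < t"
  show "k < idx \<omega>"
  proof (rule ccontr)
    assume "\<not> k < idx \<omega>"
    then have le: "real (idx \<omega>) * h \<le> real k * h" using h_pos by simp
    have "t \<le> real n * h + \<gamma> * L (real n * h) \<omega>"
      using L_nonneg[OF assms, of t] \<gamma> t by (simp add: n_h)
    then have "t \<le> real (idx \<omega>) * h + \<gamma> * L (real (idx \<omega>) * h) \<omega>"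
      unfolding idx_def by (rule LeastI)
    moreover have "\<gamma> * L (real (idx \<omega>) * h) \<omega> \<le> \<gamma> * L (real k * h) \<omega>"
      using le \<gamma> h_pos by (intro mult_left_mono mono_onD[OF mono_L[OF assms]]) auto
    ultimately show False using le * by linarith
  qed
qed

definition before :: "nat \<Rightarrow> 'a set" where "before k = {\<omega> \<in> space M. k < idx \<omega>}"

lemma before_sets: "before k \<in> sets (F (real k * h))"
proof -
  have k: "0 \<le> real k * h" using h_pos by simp
  note [measurable] = adapted_L[OF k]
  have "{\<omega> \<in> space (F (real k * h)). real k * h + \<gamma> * L (real k * h) \<omega> < t} \<in> sets (F (real k * h))"
    by measurable
  then show ?thesis
    unfolding before_def using less_idx_iff space_F[OF k] by (simp cong: conj_cong Collect_cong)
qed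

lemma before_indicator_measurable: "(indicator (before k) :: 'a \<Rightarrow> real) \<in> borel_measurable (F (real k * h))"
  using before_sets by simp

text \<open>Indicators replace the random number of summands by the fixed number \<open>n\<close>,
  so that expectations can be taken term by term.\<close>

lemma stopped_telescope:
  fixes Y :: "nat \<Rightarrow> 'a \<Rightarrow> real"
  assumes "\<omega> \<in> space M"
  shows "Y (idx \<omega>) \<omega> = Y 0 \<omega> + (\<Sum>k<n. indicator (before k) \<omega> * (Y (Suc k) \<omega> - Y k \<omega>))"
proof -
  have "(\<Sum>k<n. indicator (before k) \<omega> * (Y (Suc k) \<omega> - Y k \<omega>)) = (\<Sum>k<idx \<omega>. Y (Suc k) \<omega> - Y k \<omega>)"
    using idx_le[OF assms] assms
    by (intro sum.mono_neutral_cong_right) (auto simp: before_def indicator_def)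
  then show ?thesis by (simp add: sum_lessThan_telescope[of "\<lambda>k. Y k \<omega>"])
qed

text \<open>The drift terms stay in the formula, so it serves time, local time and powers of the
  increment as well as martingales.\<close>

lemma stopped_expectation:
  fixes Y :: "nat \<Rightarrow> 'a \<Rightarrow> real"
  assumes Y: "\<And>k. k \<le> n \<Longrightarrow> integrable (P x) (Y k)"
  shows "integrable (P x) (\<lambda>\<omega>. Y (idx \<omega>) \<omega>)"
    and "(\<integral>\<omega>. Y (idx \<omega>) \<omega> \<partial>P x) = (\<integral>\<omega>. Y 0 \<omega> \<partial>P x) +
      (\<Sum>k<n. \<integral>\<omega>. indicator (before k) \<omega> * (Y (Suc k) \<omega> - Y k \<omega>) \<partial>P x)"
proof -
  have int: "integrable (P x) (\<lambda>\<omega>. indicator (before k) \<omega> * (Y (Suc k) \<omega> - Y k \<omega>))" if "k < n" for k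
    using that h_pos
    by (intro integrable_bounded_var_mult[OF bounded_var_indicator before_indicator_measurable]
        Bochner_Integration.integrable_diff Y) auto
  have "has_bochner_integral (P x)
      (\<lambda>\<omega>. Y 0 \<omega> + (\<Sum>k<n. indicator (before k) \<omega> * (Y (Suc k) \<omega> - Y k \<omega>)))
      ((\<integral>\<omega>. Y 0 \<omega> \<partial>P x) + (\<Sum>k<n. \<integral>\<omega>. indicator (before k) \<omega> * (Y (Suc k) \<omega> - Y k \<omega>) \<partial>P x))"
    by (intro has_bochner_integral_add has_bochner_integral_sum has_bochner_integral_integrable Y int) auto
  moreover have "Y (idx \<omega>) \<omega> = Y 0 \<omega> + (\<Sum>k<n. indicator (before k) \<omega> * (Y (Suc k) \<omega> - Y k \<omega>))"
    if "\<omega> \<in> space (P x)" for \<omega>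
    using stopped_telescope that by (simp add: space_P)
  ultimately have "has_bochner_integral (P x) (\<lambda>\<omega>. Y (idx \<omega>) \<omega>)
      ((\<integral>\<omega>. Y 0 \<omega> \<partial>P x) + (\<Sum>k<n. \<integral>\<omega>. indicator (before k) \<omega> * (Y (Suc k) \<omega> - Y k \<omega>) \<partial>P x))"
    by (subst has_bochner_integral_cong[OF refl _ refl]) auto
  then show "integrable (P x) (\<lambda>\<omega>. Y (idx \<omega>) \<omega>)"
    and "(\<integral>\<omega>. Y (idx \<omega>) \<omega> \<partial>P x) = (\<integral>\<omega>. Y 0 \<omega> \<partial>P x) +
      (\<Sum>k<n. \<integral>\<omega>. indicator (before k) \<omega> * (Y (Suc k) \<omega> - Y k \<omega>) \<partial>P x)"
    by (auto simp: has_bochner_integral_iff)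
qed

definition \<sigma> :: "'a \<Rightarrow> real" where "\<sigma> \<omega> = real (idx \<omega>) * h"

lemma sigma_bounds: "\<omega> \<in> space M \<Longrightarrow> 0 \<le> \<sigma> \<omega> \<and> \<sigma> \<omega> \<le> t"
  using mult_right_mono[of "real (idx \<omega>)" "real n" h] idx_le[of \<omega>] h_pos n_h by (simp add: \<sigma>_def)

lemma stopped_tanaka:
  shows "integrable (P x) (\<lambda>\<omega>. \<bar>B (\<sigma> \<omega>) \<omega>\<bar>)" "integrable (P x) (\<lambda>\<omega>. L (\<sigma> \<omega>) \<omega>)"
    and "(\<integral>\<omega>. \<bar>B (\<sigma> \<omega>) \<omega>\<bar> \<partial>P x) = \<bar>x\<bar> + (\<integral>\<omega>. L (\<sigma> \<omega>) \<omega> \<partial>P x)"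
proof -
  interpret prob_space "P x" by (rule prob_space_P)
  have k: "0 \<le> real k * h" for k using h_pos by simp
  show iB: "integrable (P x) (\<lambda>\<omega>. \<bar>B (\<sigma> \<omega>) \<omega>\<bar>)"
    unfolding \<sigma>_def by (rule stopped_expectation(1)) (intro integrable_abs B_integrable k)
  show iL: "integrable (P x) (\<lambda>\<omega>. L (\<sigma> \<omega>) \<omega>)"
    unfolding \<sigma>_def by (rule stopped_expectation(1)) (intro L_integrable k)
  let ?Y = "\<lambda>k \<omega>. \<bar>B (real k * h) \<omega>\<bar> - \<bar>B 0 \<omega>\<bar> - L (real k * h) \<omega>"
  have Y0: "AE \<omega> in P x. ?Y 0 \<omega> = 0"
    by (rule AE_I2) (simp add: space_P start_L)
  have increment: "(\<integral>\<omega>. indicator (before k) \<omega> * (?Y (Suc k) \<omega> - ?Y k \<omega>) \<partial>P x) = 0" for k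
    by (rule ito_integral_martingale[OF tanaka before_sets]) (use h_pos in \<open>simp_all add: field_simps\<close>)
  have "(\<integral>\<omega>. ?Y (idx \<omega>) \<omega> \<partial>P x) = (\<integral>\<omega>. ?Y 0 \<omega> \<partial>P x) +
      (\<Sum>k<n. \<integral>\<omega>. indicator (before k) \<omega> * (?Y (Suc k) \<omega> - ?Y k \<omega>) \<partial>P x)"
    by (rule stopped_expectation(2)[OF ito_integral_integrable[OF tanaka k]])
  also have "\<dots> = 0"
    unfolding increment integral_eq_zero_AE[OF Y0] by simp
  finally have "(\<integral>\<omega>. \<bar>B (\<sigma> \<omega>) \<omega>\<bar> - \<bar>B 0 \<omega>\<bar> - L (\<sigma> \<omega>) \<omega> \<partial>P x) = 0"
    by (simp add: \<sigma>_def)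
  moreover have "(\<integral>\<omega>. \<bar>B 0 \<omega>\<bar> \<partial>P x) = \<bar>x\<bar>"
  proof -
    have "AE \<omega> in P x. \<bar>B 0 \<omega>\<bar> = \<bar>x\<bar>" using AE_start[of x] by eventually_elim simp
    then have "(\<integral>\<omega>. \<bar>B 0 \<omega>\<bar> \<partial>P x) = (\<integral>\<omega>. \<bar>x\<bar> \<partial>P x)"
      using B_measurable_P[of 0 x] by (intro integral_cong_AE) auto
    then show ?thesis by (simp add: prob_space)
  qed
  ultimately show "(\<integral>\<omega>. \<bar>B (\<sigma> \<omega>) \<omega>\<bar> \<partial>P x) = \<bar>x\<bar> + (\<integral>\<omega>. L (\<sigma> \<omega>) \<omega> \<partial>P x)"
    using iB iL B_integrable[of 0 x] by simp
qed

section \<open>Moments of the stopped Brownian increment\<close>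

lemma increment_power_integrable:
  "integrable (P x) (\<lambda>\<omega>. (B (real k * h) \<omega> - B 0 \<omega>) ^ j)"
  using increment_moment(1)[of 0 "real k * h" x j] h_pos by simp

lemma stopped_power_integrable:
  "integrable (P x) (\<lambda>\<omega>. (B (\<sigma> \<omega>) \<omega> - B 0 \<omega>) ^ j)"
  unfolding \<sigma>_def by (rule stopped_expectation(1)) (rule increment_power_integrable)

text \<open>All mixed moments of the past increment and the next step at once; the binomial
  expansions of the stopped powers reduce to them.\<close>

lemma before_increment_expectation:
  "has_bochner_integral (P x) (\<lambda>\<omega>. indicator (before k) \<omega> * (B (real k * h) \<omega> - B 0 \<omega>) ^ i *
      (B (real (Suc k) * h) \<omega> - B (real k * h) \<omega>) ^ j)
    ((\<integral>\<omega>. indicator (before k) \<omega> * (B (real k * h) \<omega> - B 0 \<omega>) ^ i \<partial>P x) *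
      (\<integral>\<omega>. (B (real (Suc k) * h) \<omega> - B (real k * h) \<omega>) ^ j \<partial>P x))"
proof -
  have k: "0 \<le> real k * h" "real k * h \<le> real (Suc k) * h" using h_pos by (auto simp: field_simps)
  have m: "(\<lambda>\<omega>. indicator (before k) \<omega> * (B (real k * h) \<omega> - B 0 \<omega>) ^ i) \<in> borel_measurable (F (real k * h))"
    by (intro borel_measurable_times borel_measurable_power borel_measurable_diff
        before_indicator_measurable B_measurable_F k order_refl)
  have i: "integrable (P x) (\<lambda>\<omega>. indicator (before k) \<omega> * (B (real k * h) \<omega> - B 0 \<omega>) ^ i)"
    by (rule integrable_bounded_var_mult[OF bounded_var_indicator before_indicator_measurable k(1)
        increment_power_integrable])
  show ?thesis
    using increment_expectation[OF m i k, of j] unfolding has_bochner_integral_iff by (rule conjI)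
qed

lemma step_moments:
  shows "(\<integral>\<omega>. (B (real (Suc k) * h) \<omega> - B (real k * h) \<omega>) \<partial>P x) = 0"
    and "(\<integral>\<omega>. (B (real (Suc k) * h) \<omega> - B (real k * h) \<omega>)\<^sup>2 \<partial>P x) = h"
    and "(\<integral>\<omega>. (B (real (Suc k) * h) \<omega> - B (real k * h) \<omega>) ^ 3 \<partial>P x) = 0"
    and "(\<integral>\<omega>. (B (real (Suc k) * h) \<omega> - B (real k * h) \<omega>) ^ 4 \<partial>P x) = 3 * h\<^sup>2"
proof -
  have k: "0 \<le> real k * h" "real k * h \<le> real (Suc k) * h" "real (Suc k) * h - real k * h = h"
    using h_pos by (auto simp: field_simps)
  show "(\<integral>\<omega>. (B (real (Suc k) * h) \<omega> - B (real k * h) \<omega>) \<partial>P x) = 0"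
    using increment_moment(2)[OF k(1,2), of 1 x] by simp
  show "(\<integral>\<omega>. (B (real (Suc k) * h) \<omega> - B (real k * h) \<omega>)\<^sup>2 \<partial>P x) = h"
    using increment_moment(3)[OF k(1,2), of x] k(3) by simp
  show "(\<integral>\<omega>. (B (real (Suc k) * h) \<omega> - B (real k * h) \<omega>) ^ 3 \<partial>P x) = 0"
    using increment_moment(2)[OF k(1,2), of 3 x] by simp
  show "(\<integral>\<omega>. (B (real (Suc k) * h) \<omega> - B (real k * h) \<omega>) ^ 4 \<partial>P x) = 3 * h\<^sup>2"
    using increment_moment(4)[OF k(1,2), of x] k(3) by simp
qed

text \<open>The sum is kept in this form because the second moment of the stopped increment produces
  the same terms.\<close>

lemma sigma_integrable: "integrable (P x) \<sigma>"
  and sigma_expectation: "(\<integral>\<omega>. \<sigma> \<omega> \<partial>P x) = (\<Sum>k<n. h * (\<integral>\<omega>. indicator (before k) \<omega> \<partial>P x))"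
proof -
  interpret prob_space "P x" by (rule prob_space_P)
  have i: "integrable (P x) (\<lambda>\<omega>. real k * h)" for k by simp
  show "integrable (P x) \<sigma>"
    using stopped_expectation(1)[of x "\<lambda>k _. real k * h", OF i] by (simp add: \<sigma>_def[abs_def])
  have "(\<integral>\<omega>. \<sigma> \<omega> \<partial>P x) =
      (\<Sum>k<n. \<integral>\<omega>. indicator (before k) \<omega> * (real (Suc k) * h - real k * h) \<partial>P x)"
    using stopped_expectation(2)[of x "\<lambda>k _. real k * h", OF i] by (simp add: \<sigma>_def)
  also have "\<dots> = (\<Sum>k<n. h * (\<integral>\<omega>. indicator (before k) \<omega> \<partial>P x))"
  proof -
    have "real (Suc k) * h - real k * h = h" for k by (simp add: algebra_simps)
    then show ?thesis by (simp only: mult.commute integral_mult_right_zero)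
  qed
  finally show "(\<integral>\<omega>. \<sigma> \<omega> \<partial>P x) = (\<Sum>k<n. h * (\<integral>\<omega>. indicator (before k) \<omega> \<partial>P x))" .
qed

lemma stopped_first_moment: "(\<integral>\<omega>. B (\<sigma> \<omega>) \<omega> - B 0 \<omega> \<partial>P x) = 0"
proof -
  have "(\<integral>\<omega>. B (\<sigma> \<omega>) \<omega> - B 0 \<omega> \<partial>P x) =
    (\<Sum>k<n. \<integral>\<omega>. indicator (before k) \<omega> * (B (real (Suc k) * h) \<omega> - B (real k * h) \<omega>) \<partial>P x)"
    using stopped_expectation(2)[of x "\<lambda>k \<omega>. (B (real k * h) \<omega> - B 0 \<omega>)"]
      increment_power_integrable[of x _ 1]
    by (simp add: \<sigma>_def)
  also have "\<dots> = 0"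
    using has_bochner_integral_integral_eq[OF before_increment_expectation[where i = 0 and j = 1 and x = x]]
    by (simp add: step_moments(1) del: of_nat_Suc)
  finally show ?thesis .
qed

lemma stopped_second_moment: "(\<integral>\<omega>. (B (\<sigma> \<omega>) \<omega> - B 0 \<omega>)\<^sup>2 \<partial>P x) = (\<integral>\<omega>. \<sigma> \<omega> \<partial>P x)"
proof -
  let ?W = "\<lambda>k \<omega>. B (real k * h) \<omega> - B 0 \<omega>" and ?D = "\<lambda>k \<omega>. B (real (Suc k) * h) \<omega> - B (real k * h) \<omega>"
  have step: "(\<integral>\<omega>. indicator (before k) \<omega> * ((?W (Suc k) \<omega>)\<^sup>2 - (?W k \<omega>)\<^sup>2) \<partial>P x) =
      h * (\<integral>\<omega>. indicator (before k) \<omega> \<partial>P x)" for k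
  proof -
    \<comment> \<open>The exponents 1 and 0 are written out to match
      \<open>before_increment_expectation\<close>; the cross term has mean 0.\<close>
    have "indicator (before k) \<omega> * ((?W (Suc k) \<omega>)\<^sup>2 - (?W k \<omega>)\<^sup>2) =
        2 * (indicator (before k) \<omega> * ?W k \<omega> ^ 1 * ?D k \<omega> ^ 1) +
        indicator (before k) \<omega> * ?W k \<omega> ^ 0 * ?D k \<omega> ^ 2" for \<omega>
      by (simp add: power2_eq_square algebra_simps)
    then have "(\<integral>\<omega>. indicator (before k) \<omega> * ((?W (Suc k) \<omega>)\<^sup>2 - (?W k \<omega>)\<^sup>2) \<partial>P x) =
        2 * ((\<integral>\<omega>. indicator (before k) \<omega> * ?W k \<omega> ^ 1 \<partial>P x) * (\<integral>\<omega>. ?D k \<omega> ^ 1 \<partial>P x)) +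
        (\<integral>\<omega>. indicator (before k) \<omega> * ?W k \<omega> ^ 0 \<partial>P x) * (\<integral>\<omega>. ?D k \<omega> ^ 2 \<partial>P x)"
      by (simp only: has_bochner_integral_integral_eq[OF has_bochner_integral_add[OF
          has_bochner_integral_mult_right[OF before_increment_expectation] before_increment_expectation]])
    also have "\<dots> = h * (\<integral>\<omega>. indicator (before k) \<omega> \<partial>P x)"
      unfolding step_moments power_one_right by simp
    finally show ?thesis .
  qed
  have "(\<integral>\<omega>. (B (\<sigma> \<omega>) \<omega> - B 0 \<omega>)\<^sup>2 \<partial>P x) =
    (\<Sum>k<n. \<integral>\<omega>. indicator (before k) \<omega> * ((?W (Suc k) \<omega>)\<^sup>2 - (?W k \<omega>)\<^sup>2) \<partial>P x)"
    using stopped_expectation(2)[of x "\<lambda>k \<omega>. (?W k \<omega>)\<^sup>2"] increment_power_integrable[of x _ 2]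
    by (simp add: \<sigma>_def)
  then show ?thesis unfolding step sigma_expectation .
qed

text \<open>In the expansion of (W + D)^4 - W^4 the odd moments of the step D vanish, leaving at
  most 6 h t + 3 h^2 per step. Over n = t / h steps this is 6 t^2 + 3 h t, and h \<le> t makes the
  bound independent of the mesh.\<close>

lemma stopped_fourth_moment: "(\<integral>\<omega>. (B (\<sigma> \<omega>) \<omega> - B 0 \<omega>) ^ 4 \<partial>P x) \<le> 9 * t\<^sup>2"
proof -
  interpret prob_space "P x" by (rule prob_space_P)
  let ?W = "\<lambda>k \<omega>. B (real k * h) \<omega> - B 0 \<omega>" and ?D = "\<lambda>k \<omega>. B (real (Suc k) * h) \<omega> - B (real k * h) \<omega>"
  let ?Z = "\<lambda>k i \<omega>. indicator (before k) \<omega> * ?W k \<omega> ^ i :: real"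
  have step: "(\<integral>\<omega>. indicator (before k) \<omega> * (?W (Suc k) \<omega> ^ 4 - ?W k \<omega> ^ 4) \<partial>P x) \<le> 6 * h * t + 3 * h\<^sup>2"
    if "k < n" for k
  proof -
    have "indicator (before k) \<omega> * (?W (Suc k) \<omega> ^ 4 - ?W k \<omega> ^ 4) =
        4 * (?Z k 3 \<omega> * ?D k \<omega> ^ 1) + 6 * (?Z k 2 \<omega> * ?D k \<omega> ^ 2) +
        4 * (?Z k 1 \<omega> * ?D k \<omega> ^ 3) + ?Z k 0 \<omega> * ?D k \<omega> ^ 4" for \<omega>
    proof -
      have "(w + d) ^ 4 - w ^ 4 = 4 * (w ^ 3 * d) + 6 * (w\<^sup>2 * d\<^sup>2) + 4 * (w * d ^ 3) + d ^ 4" for w d :: real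
        by (simp add: power4_eq_xxxx power3_eq_cube power2_eq_square algebra_simps)
      from this[of "?W k \<omega>" "?D k \<omega>"]
      have "?W (Suc k) \<omega> ^ 4 - ?W k \<omega> ^ 4 = 4 * (?W k \<omega> ^ 3 * ?D k \<omega>) + 6 * ((?W k \<omega>)\<^sup>2 * (?D k \<omega>)\<^sup>2) +
          4 * (?W k \<omega> * ?D k \<omega> ^ 3) + ?D k \<omega> ^ 4" by simp
      then show ?thesis by (simp add: distrib_left mult_ac)
    qed
    then have "(\<integral>\<omega>. indicator (before k) \<omega> * (?W (Suc k) \<omega> ^ 4 - ?W k \<omega> ^ 4) \<partial>P x) =
        4 * ((\<integral>\<omega>. ?Z k 3 \<omega> \<partial>P x) * (\<integral>\<omega>. ?D k \<omega> ^ 1 \<partial>P x)) +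
        6 * ((\<integral>\<omega>. ?Z k 2 \<omega> \<partial>P x) * (\<integral>\<omega>. ?D k \<omega> ^ 2 \<partial>P x)) +
        4 * ((\<integral>\<omega>. ?Z k 1 \<omega> \<partial>P x) * (\<integral>\<omega>. ?D k \<omega> ^ 3 \<partial>P x)) +
        (\<integral>\<omega>. ?Z k 0 \<omega> \<partial>P x) * (\<integral>\<omega>. ?D k \<omega> ^ 4 \<partial>P x)"
      by (simp only: has_bochner_integral_integral_eq[OF has_bochner_integral_add[OF
          has_bochner_integral_add[OF has_bochner_integral_add[OF
          has_bochner_integral_mult_right[OF before_increment_expectation]
          has_bochner_integral_mult_right[OF before_increment_expectation]]
          has_bochner_integral_mult_right[OF before_increment_expectation]]
          before_increment_expectation]])
    also have "\<dots> = 6 * (\<integral>\<omega>. ?Z k 2 \<omega> \<partial>P x) * h + (\<integral>\<omega>. ?Z k 0 \<omega> \<partial>P x) * (3 * h\<^sup>2)"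
      unfolding step_moments power_one_right by simp
    also have "\<dots> \<le> 6 * t * h + 1 * (3 * h\<^sup>2)"
    proof (intro add_mono mult_right_mono mult_left_mono)
      have "(\<integral>\<omega>. ?Z k 2 \<omega> \<partial>P x) \<le> (\<integral>\<omega>. ?W k \<omega> ^ 2 \<partial>P x)"
      proof (rule integral_mono)
        show "integrable (P x) (?Z k 2)"
          using h_pos by (intro integrable_bounded_var_mult[OF bounded_var_indicator before_indicator_measurable]
              increment_power_integrable) auto
      qed (auto simp: increment_power_integrable split: split_indicator)
      also have "\<dots> = real k * h"
        using increment_moment(3)[of 0 "real k * h" x] h_pos by simp
      also have "\<dots> \<le> real n * h" using that h_pos by (intro mult_right_mono) auto
      finally show "(\<integral>\<omega>. ?Z k 2 \<omega> \<partial>P x) \<le> t" by (simp add: n_h)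
      have "before k \<in> sets (P x)" using sets_F_P[OF before_sets] h_pos by simp
      then show "(\<integral>\<omega>. ?Z k 0 \<omega> \<partial>P x) \<le> 1" by simp
    qed (use h_pos in auto)
    finally show ?thesis by (simp add: mult_ac)
  qed
  have "(\<integral>\<omega>. (B (\<sigma> \<omega>) \<omega> - B 0 \<omega>) ^ 4 \<partial>P x) =
    (\<Sum>k<n. \<integral>\<omega>. indicator (before k) \<omega> * (?W (Suc k) \<omega> ^ 4 - ?W k \<omega> ^ 4) \<partial>P x)"
    using stopped_expectation(2)[of x "\<lambda>k \<omega>. ?W k \<omega> ^ 4"] increment_power_integrable[of x _ 4]
    by (simp add: \<sigma>_def)
  also have "\<dots> \<le> (\<Sum>k<n. 6 * h * t + 3 * h\<^sup>2)"
    by (intro sum_mono step) simp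
  also have "\<dots> = 6 * t * (real n * h) + 3 * h * (real n * h)"
    by (simp add: power2_eq_square algebra_simps)
  also have "\<dots> \<le> 9 * t\<^sup>2"
    using mult_right_mono[OF h_le, of t] t unfolding n_h by (simp add: power2_eq_square)
  finally show ?thesis .
qed

end

context stopping_grid
begin

text \<open>Since \<open>L\<close> is the compensator of \<open>\<bar>B\<bar>\<close> and \<open>B\<close> is centred, \<open>E L\<close> equals twice the mean of the
  negative part of \<open>B\<close>, which a fourth moment bound makes small away from the origin.\<close>

lemma stopped_local_time_bound:
  assumes x: "0 \<le> x"
  shows "x ^ 3 * (\<integral>\<omega>. L (\<sigma> \<omega>) \<omega> \<partial>P x) \<le> 18 * t\<^sup>2"
proof -
  interpret prob_space "P x" by (rule prob_space_P)
  let ?W = "\<lambda>\<omega>. B (\<sigma> \<omega>) \<omega> - B 0 \<omega>"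
  have iW: "integrable (P x) ?W" using stopped_power_integrable[of x 1] by simp
  have "(\<integral>\<omega>. L (\<sigma> \<omega>) \<omega> \<partial>P x) = (\<integral>\<omega>. \<bar>B (\<sigma> \<omega>) \<omega>\<bar> \<partial>P x) - x - (\<integral>\<omega>. ?W \<omega> \<partial>P x)"
    using stopped_tanaka(3)[of x] stopped_first_moment[of x] x by simp
  also have "\<dots> = (\<integral>\<omega>. \<bar>B (\<sigma> \<omega>) \<omega>\<bar> - x - ?W \<omega> \<partial>P x)"
    using stopped_tanaka(1)[of x] iW by (simp add: prob_space)
  finally have L_eq: "(\<integral>\<omega>. L (\<sigma> \<omega>) \<omega> \<partial>P x) = (\<integral>\<omega>. \<bar>B (\<sigma> \<omega>) \<omega>\<bar> - x - ?W \<omega> \<partial>P x)" .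
  have "x ^ 3 * (\<integral>\<omega>. L (\<sigma> \<omega>) \<omega> \<partial>P x) = (\<integral>\<omega>. x ^ 3 * (\<bar>B (\<sigma> \<omega>) \<omega>\<bar> - x - ?W \<omega>) \<partial>P x)"
    unfolding L_eq by simp
  also have "\<dots> \<le> (\<integral>\<omega>. 2 * ?W \<omega> ^ 4 \<partial>P x)"
  proof (rule integral_mono_AE)
    show "integrable (P x) (\<lambda>\<omega>. x ^ 3 * (\<bar>B (\<sigma> \<omega>) \<omega>\<bar> - x - ?W \<omega>))"
      using stopped_tanaka(1)[of x] iW by simp
    show "integrable (P x) (\<lambda>\<omega>. 2 * ?W \<omega> ^ 4)"
      using stopped_power_integrable[of x 4] by simp
    show "AE \<omega> in P x. x ^ 3 * (\<bar>B (\<sigma> \<omega>) \<omega>\<bar> - x - ?W \<omega>) \<le> 2 * ?W \<omega> ^ 4"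
      using AE_start[of x]
    proof eventually_elim
      case (elim \<omega>)
      show ?case
      proof (cases "0 \<le> B (\<sigma> \<omega>) \<omega>")
        case True
        then show ?thesis using elim by simp
      next
        case False
        \<comment> \<open>The path has moved by x + b from \<open>x\<close>, so x^3 b is at most the
          fourth power of the increment, while the integrand equals 2 x^3 b. With the fourth moment
          9 t^2 this gives the constant 18.\<close>
        define b where "b = - B (\<sigma> \<omega>) \<omega>"
        have b: "0 < b" using False by (simp add: b_def)
        have "x ^ 3 * b \<le> (x + b) ^ 3 * (x + b)"
          using x b by (intro mult_mono power_mono) auto
        also have "\<dots> = (x + b) ^ 4" by (simp add: power4_eq_xxxx power3_eq_cube)
        also have "\<dots> = ?W \<omega> ^ 4"
        proof -
          have W: "?W \<omega> = - (x + b)" unfolding b_def elim by linarith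
          have even: "c ^ 4 = (- c) ^ 4" for c :: real by simp
          show ?thesis unfolding W by (rule even)
        qed
        finally have bound: "x ^ 3 * b \<le> ?W \<omega> ^ 4" .
        have "\<bar>B (\<sigma> \<omega>) \<omega>\<bar> - x - ?W \<omega> = 2 * b" using b elim unfolding b_def by linarith
        then show ?thesis using bound by (simp only:)
      qed
    qed
  qed
  also have "\<dots> \<le> 18 * t\<^sup>2" using stopped_fourth_moment[of x] by simp
  finally show ?thesis .
qed

lemma stopped_measurable:
  assumes f: "continuous_on {0..} f"
  shows "(\<lambda>\<omega>. f \<bar>B (\<sigma> \<omega>) \<omega>\<bar> :: real) \<in> borel_measurable (P x)"
proof -
  have "(\<lambda>y. f \<bar>y\<bar>) \<in> borel_measurable borel"
    by (intro borel_measurable_continuous_onI continuous_on_compose2[OF f] continuous_intros) auto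
  from measurable_compose[OF borel_measurable_integrable[OF stopped_tanaka(1)] this]
  show ?thesis by simp
qed

text \<open>\<open>p\<close> and \<open>q\<close> stand for f'(x) and f''(x). The remainder is
  estimated through the increment of \<open>B\<close> itself, whose moments are known: for x \<ge>
  0, taking absolute values does not increase the distance from x.\<close>

lemma stopped_taylor:
  assumes x: "0 \<le> x" and f: "continuous_on {0..} f" and K: "\<And>y. 0 \<le> y \<Longrightarrow> \<bar>f y\<bar> \<le> K"
    and e: "0 \<le> e" and C: "0 \<le> C"
    and taylor: "\<And>y. 0 \<le> y \<Longrightarrow> \<bar>f y - f x - p * (y - x) - q / 2 * (y - x)\<^sup>2\<bar> \<le> e * (y - x)\<^sup>2 + C * (y - x) ^ 4"
  shows "\<bar>(\<integral>\<omega>. f \<bar>B (\<sigma> \<omega>) \<omega>\<bar> \<partial>P x) - f x - p * (\<integral>\<omega>. L (\<sigma> \<omega>) \<omega> \<partial>P x) -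
        q / 2 * ((\<integral>\<omega>. \<sigma> \<omega> \<partial>P x) - 2 * x * (\<integral>\<omega>. L (\<sigma> \<omega>) \<omega> \<partial>P x))\<bar> \<le> e * t + C * (9 * t\<^sup>2)"
proof -
  interpret prob_space "P x" by (rule prob_space_P)
  let ?X = "\<lambda>\<omega>. \<bar>B (\<sigma> \<omega>) \<omega>\<bar>" and ?W = "\<lambda>\<omega>. B (\<sigma> \<omega>) \<omega> - B 0 \<omega>"
  have iX: "integrable (P x) ?X" by (rule stopped_tanaka(1))
  have mX: "?X \<in> borel_measurable (P x)" using iX by simp
  note mf = stopped_measurable[OF f, of x]
  have if': "integrable (P x) (\<lambda>\<omega>. f (?X \<omega>))"
    by (rule integrable_const_bound[of _ K]) (use mf K in auto)
  have iW: "integrable (P x) ?W" using stopped_power_integrable[of x 1] by simp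
  note iW2 = stopped_power_integrable[of x 2] and iW4 = stopped_power_integrable[of x 4]
  have dist: "AE \<omega> in P x. \<bar>?X \<omega> - x\<bar> \<le> \<bar>?W \<omega>\<bar>"
    using AE_start[of x] by eventually_elim (use x in auto)
  \<comment> \<open>As \<bar>B\<bar>^2 = B^2, the squares of the reflected and the free increment
    differ by linear terms, whose means are 0 and the mean local time. This is the source of the
    summand - 2 x l.\<close>
  have X2_AE: "AE \<omega> in P x. (?X \<omega> - x)\<^sup>2 = (?W \<omega>)\<^sup>2 + 2 * x * ?W \<omega> - 2 * x * (?X \<omega> - x)"
    using AE_start[of x] by eventually_elim (simp add: power2_eq_square algebra_simps)
  have "integrable (P x) (\<lambda>\<omega>. (?W \<omega>)\<^sup>2 + 2 * x * ?W \<omega> - 2 * x * (?X \<omega> - x))"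
    using iW2 iW iX by simp
  then have iX2: "integrable (P x) (\<lambda>\<omega>. (?X \<omega> - x)\<^sup>2)"
    by (rule integrable_cong_AE_imp) (use X2_AE mX in \<open>auto elim: eventually_mono\<close>)
  have EX: "(\<integral>\<omega>. ?X \<omega> - x \<partial>P x) = (\<integral>\<omega>. L (\<sigma> \<omega>) \<omega> \<partial>P x)"
    using stopped_tanaka(3)[of x] iX x by (simp add: prob_space)
  have "(\<integral>\<omega>. (?X \<omega> - x)\<^sup>2 \<partial>P x) = (\<integral>\<omega>. (?W \<omega>)\<^sup>2 + 2 * x * ?W \<omega> - 2 * x * (?X \<omega> - x) \<partial>P x)"
    using iX2 iW2 iW iX X2_AE by (intro integral_cong_AE) auto
  also have "\<dots> = (\<integral>\<omega>. (?W \<omega>)\<^sup>2 \<partial>P x) + 2 * x * (\<integral>\<omega>. ?W \<omega> \<partial>P x) - 2 * x * (\<integral>\<omega>. ?X \<omega> - x \<partial>P x)"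
  proof -
    have "integrable (P x) (\<lambda>\<omega>. ?X \<omega> - x)" using iX by simp
    note * = has_bochner_integral_integrable[OF iW2] has_bochner_integral_integrable[OF iW]
      has_bochner_integral_integrable[OF this]
    show ?thesis
      by (rule has_bochner_integral_integral_eq[OF has_bochner_integral_diff[OF
          has_bochner_integral_add[OF *(1) has_bochner_integral_mult_right[OF *(2)]]
          has_bochner_integral_mult_right[OF *(3)]]])
  qed
  also have "\<dots> = (\<integral>\<omega>. \<sigma> \<omega> \<partial>P x) - 2 * x * (\<integral>\<omega>. L (\<sigma> \<omega>) \<omega> \<partial>P x)"
    unfolding EX stopped_first_moment stopped_second_moment by simp
  finally have EX2: "(\<integral>\<omega>. (?X \<omega> - x)\<^sup>2 \<partial>P x) = (\<integral>\<omega>. \<sigma> \<omega> \<partial>P x) - 2 * x * (\<integral>\<omega>. L (\<sigma> \<omega>) \<omega> \<partial>P x)" .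
  let ?R = "\<lambda>\<omega>. f (?X \<omega>) - f x - p * (?X \<omega> - x) - q / 2 * (?X \<omega> - x)\<^sup>2"
  have iR: "integrable (P x) ?R" using if' iX iX2 by simp
  have "(\<integral>\<omega>. ?R \<omega> \<partial>P x) = (\<integral>\<omega>. f (?X \<omega>) \<partial>P x) - f x - p * (\<integral>\<omega>. ?X \<omega> - x \<partial>P x) -
      q / 2 * (\<integral>\<omega>. (?X \<omega> - x)\<^sup>2 \<partial>P x)"
    using if' iX iX2 by (simp add: prob_space)
  then have R_eq: "(\<integral>\<omega>. ?R \<omega> \<partial>P x) = (\<integral>\<omega>. f (?X \<omega>) \<partial>P x) - f x - p * (\<integral>\<omega>. L (\<sigma> \<omega>) \<omega> \<partial>P x) -
        q / 2 * ((\<integral>\<omega>. \<sigma> \<omega> \<partial>P x) - 2 * x * (\<integral>\<omega>. L (\<sigma> \<omega>) \<omega> \<partial>P x))"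
    unfolding EX EX2 .
  have "\<bar>\<integral>\<omega>. ?R \<omega> \<partial>P x\<bar> \<le> (\<integral>\<omega>. \<bar>?R \<omega>\<bar> \<partial>P x)"
    by (rule integral_abs_bound)
  also have "\<dots> \<le> (\<integral>\<omega>. e * (?W \<omega>)\<^sup>2 + C * ?W \<omega> ^ 4 \<partial>P x)"
  proof (rule integral_mono_AE)
    show "integrable (P x) (\<lambda>\<omega>. \<bar>?R \<omega>\<bar>)" by (rule integrable_abs[OF iR])
    show "integrable (P x) (\<lambda>\<omega>. e * (?W \<omega>)\<^sup>2 + C * ?W \<omega> ^ 4)" using iW2 iW4 by simp
    show "AE \<omega> in P x. \<bar>?R \<omega>\<bar> \<le> e * (?W \<omega>)\<^sup>2 + C * ?W \<omega> ^ 4"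
      using dist
    proof eventually_elim
      case (elim \<omega>)
      have "\<bar>?R \<omega>\<bar> \<le> e * (?X \<omega> - x)\<^sup>2 + C * (?X \<omega> - x) ^ 4" by (rule taylor) simp
      also have "\<dots> \<le> e * (?W \<omega>)\<^sup>2 + C * ?W \<omega> ^ 4"
        using power_mono[OF elim, of 2] power_mono[OF elim, of 4] e C
        by (intro add_mono mult_left_mono) simp_all
      finally show ?case .
    qed
  qed
  also have "\<dots> = e * (\<integral>\<omega>. \<sigma> \<omega> \<partial>P x) + C * (\<integral>\<omega>. ?W \<omega> ^ 4 \<partial>P x)"
    using iW2 iW4 by (simp add: stopped_second_moment)
  also have "\<dots> \<le> e * t + C * (9 * t\<^sup>2)"
  proof (intro add_mono mult_left_mono stopped_fourth_moment e C)
    have "(\<integral>\<omega>. \<sigma> \<omega> \<partial>P x) \<le> (\<integral>\<omega>. t \<partial>P x)"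
      using sigma_bounds sigma_integrable[of x] by (intro integral_mono) (auto simp: space_P)
    then show "(\<integral>\<omega>. \<sigma> \<omega> \<partial>P x) \<le> t" by (simp add: prob_space)
  qed
  finally show ?thesis unfolding R_eq .
qed

end

section \<open>Small time expansion of the semigroup\<close>

context brownian_local_time
begin

lemma clock_strict_mono:
  assumes "0 < \<gamma>" "\<omega> \<in> space M" "0 \<le> r" "r < s"
  shows "r + \<gamma> * L r \<omega> < s + \<gamma> * L s \<omega>"
proof -
  have "\<gamma> * L r \<omega> \<le> \<gamma> * L s \<omega>"
    using assms by (intro mult_left_mono mono_onD[OF mono_L]) auto
  then show ?thesis using assms by linarith
qed

text \<open>\<open>the_inv_into\<close> is meaningful only where a unique preimage exists.
  Existence, within [0, t], follows from the intermediate value theorem, as s + \<gamma> L s is 0 at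
  s = 0 and at least t at s = t; uniqueness follows from strict monotonicity.\<close>

lemma sticky_clock_props:
  assumes \<gamma>: "0 < \<gamma>" and \<omega>: "\<omega> \<in> space M" and t: "0 \<le> t"
  defines "\<tau> \<equiv> sticky_clock \<gamma> L t \<omega>"
  shows "0 \<le> \<tau>" "\<tau> \<le> t" "\<tau> + \<gamma> * L \<tau> \<omega> = t"
proof -
  let ?\<phi> = "\<lambda>s. s + \<gamma> * L s \<omega>"
  have "continuous_on {0..t} (\<lambda>s. L s \<omega>)"
    by (rule continuous_on_subset[OF continuous_L[OF \<omega>]]) auto
  then have cont: "continuous_on {0..t} ?\<phi>" by (intro continuous_intros)
  have "?\<phi> 0 \<le> t" "t \<le> ?\<phi> t"
    using start_L[OF \<omega>] L_nonneg[OF \<omega> t] \<gamma> t by simp_all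
  from IVT'[of ?\<phi>, OF this t cont] obtain s where s: "0 \<le> s" "s \<le> t" "?\<phi> s = t" by blast
  have "inj_on ?\<phi> {0..}"
  proof (rule linorder_inj_onI)
    fix r s :: real assume "r < s" "r \<in> {0..}"
    then show "?\<phi> r \<noteq> ?\<phi> s" using clock_strict_mono[OF \<gamma> \<omega>, of r s] by simp
  qed auto
  from the_inv_into_f_f[OF this, of s] s have "\<tau> = s"
    by (simp add: \<tau>_def sticky_clock_def)
  then show "0 \<le> \<tau>" "\<tau> \<le> t" "\<tau> + \<gamma> * L \<tau> \<omega> = t" using s by simp_all
qed

end

text \<open>\<open>\<sigma>\<close> is the clock rounded up to the grid: it is not before the clock,
  and the grid point preceding it, if any, is not after the clock.\<close>

lemma (in stopping_grid) sigma_approximates_clock: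
  assumes \<omega>: "\<omega> \<in> space M"
  shows "\<bar>\<sigma> \<omega> - sticky_clock \<gamma> L t \<omega>\<bar> \<le> t / real n"
proof -
  define \<tau> where "\<tau> = sticky_clock \<gamma> L t \<omega>"
  have \<tau>: "0 \<le> \<tau>" "\<tau> \<le> t" "\<tau> + \<gamma> * L \<tau> \<omega> = t"
    unfolding \<tau>_def using sticky_clock_props[OF \<gamma> \<omega>, of t] t by auto
  have "\<not> real (idx \<omega>) * h + \<gamma> * L (real (idx \<omega>) * h) \<omega> < t"
    using less_idx_iff[OF \<omega>, of "idx \<omega>"] by simp
  then have "\<not> \<sigma> \<omega> < \<tau>"
    using clock_strict_mono[OF \<gamma> \<omega>, of "\<sigma> \<omega>" \<tau>] sigma_bounds[OF \<omega>] \<tau>(3) by (auto simp: \<sigma>_def)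
  moreover have "\<sigma> \<omega> \<le> \<tau> + h"
  proof (cases "idx \<omega>")
    case 0
    then show ?thesis using \<tau> h_pos by (simp add: \<sigma>_def)
  next
    case (Suc k)
    then have "real k * h + \<gamma> * L (real k * h) \<omega> < t"
      using less_idx_iff[OF \<omega>, of k] by simp
    then have "\<not> \<tau> < real k * h"
      using clock_strict_mono[OF \<gamma> \<omega> \<tau>(1), of "real k * h"] \<tau>(3) by linarith
    then show ?thesis using Suc by (simp add: \<sigma>_def algebra_simps)
  qed
  ultimately show ?thesis using h_pos unfolding h_def \<tau>_def by linarith
qed

context brownian_local_time
begin

context
  fixes \<gamma> t :: real
  assumes \<gamma>: "0 < \<gamma>" and t: "0 < t"
begin

definition grid_time :: "nat \<Rightarrow> 'a \<Rightarrow> real" where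
  "grid_time m \<omega> = stopping_grid.\<sigma> L \<gamma> t (Suc m) \<omega>"

lemma stopping_grid_Suc: "stopping_grid M P F B \<theta> L \<gamma> t (Suc m)"
  by unfold_locales (use \<gamma> t in auto)

lemmas grid_facts = stopping_grid.sigma_bounds[OF stopping_grid_Suc, folded grid_time_def]
  stopping_grid.sigma_approximates_clock[OF stopping_grid_Suc, folded grid_time_def]

lemma grid_time_tendsto:
  assumes "\<omega> \<in> space M"
  shows "(\<lambda>m. grid_time m \<omega>) \<longlonglongrightarrow> sticky_clock \<gamma> L t \<omega>"
proof (rule LIM_zero_cancel, rule Lim_null_comparison)
  show "\<forall>\<^sub>F m in sequentially. norm (grid_time m \<omega> - sticky_clock \<gamma> L t \<omega>) \<le> t / real (Suc m)"
    using grid_facts(2)[OF assms] by (intro always_eventually) simp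
  show "(\<lambda>m. t / real (Suc m)) \<longlonglongrightarrow> 0" by real_asymp
qed

lemma grid_path_tendsto:
  assumes \<omega>: "\<omega> \<in> space M" and p: "continuous_on {0..} (p :: real \<Rightarrow> real)"
  shows "(\<lambda>m. p (grid_time m \<omega>)) \<longlonglongrightarrow> p (sticky_clock \<gamma> L t \<omega>)"
  by (rule continuous_on_tendsto_compose[OF p grid_time_tendsto[OF \<omega>]])
     (use sticky_clock_props(1)[OF \<gamma> \<omega>, of t] t grid_facts(1)[OF \<omega>] in auto)

lemma grid_measurable:
  "continuous_on {0..} f \<Longrightarrow> (\<lambda>\<omega>. f \<bar>B (grid_time m \<omega>) \<omega>\<bar> :: real) \<in> borel_measurable (P x)"
  unfolding grid_time_def by (rule stopping_grid.stopped_measurable[OF stopping_grid_Suc])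

lemma grid_sticky_tendsto:
  fixes f :: "real \<Rightarrow> real"
  assumes f: "continuous_on {0..} f" and \<omega>: "\<omega> \<in> space (P x)"
  shows "(\<lambda>m. f \<bar>B (grid_time m \<omega>) \<omega>\<bar>) \<longlonglongrightarrow> f (sticky_bm \<gamma> B L t \<omega>)"
proof -
  have "continuous_on {0..} (\<lambda>s. B s \<omega>)" using continuous_B \<omega> by (simp add: space_P)
  then have "continuous_on {0..} (\<lambda>s. f \<bar>B s \<omega>\<bar>)"
    by (intro continuous_on_compose2[OF f] continuous_intros) auto
  from grid_path_tendsto[OF _ this] \<omega> show ?thesis by (simp add: space_P sticky_bm_def)
qed

text \<open>Measurability of the time-changed path is inherited from its grid approximations, which
  converge at every \<omega> by path continuity.\<close>

lemma sticky_measurable: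
  fixes f :: "real \<Rightarrow> real"
  assumes "continuous_on {0..} f"
  shows "(\<lambda>\<omega>. f (sticky_bm \<gamma> B L t \<omega>)) \<in> borel_measurable (P x)"
  by (rule borel_measurable_LIMSEQ_real[OF grid_sticky_tendsto[OF assms] grid_measurable[OF assms]])

lemma sticky_semigroup_integrable:
  assumes "f \<in> C0_Rplus"
  shows "integrable (P x) (\<lambda>\<omega>. f (sticky_bm \<gamma> B L t \<omega>))"
proof -
  interpret prob_space "P x" by (rule prob_space_P)
  obtain K where "\<And>y. 0 \<le> y \<Longrightarrow> \<bar>f y\<bar> \<le> K" using C0_Rplus_bounded[OF assms] by blast
  moreover have "(\<lambda>\<omega>. f (sticky_bm \<gamma> B L t \<omega>)) \<in> borel_measurable (P x)"
    using assms by (intro sticky_measurable) (simp add: C0_Rplus_def)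
  ultimately show ?thesis
    by (intro integrable_const_bound[of _ K]) (auto simp: sticky_bm_def)
qed

text \<open>\<open>l\<close> is the mean local time at the clock; its two upper bounds handle small
  and large \<open>x\<close>. Everything is a limit of the grid versions, in which \<open>L\<close>
  is dominated by the integrable \<open>L t\<close>.\<close>

lemma sticky_expansion:
  assumes x: "0 \<le> x" and f: "continuous_on {0..} f" and K: "\<And>y. 0 \<le> y \<Longrightarrow> \<bar>f y\<bar> \<le> K"
    and e: "0 \<le> e" and C: "0 \<le> C"
    and taylor: "\<And>y. 0 \<le> y \<Longrightarrow> \<bar>f y - f x - p * (y - x) - q / 2 * (y - x)\<^sup>2\<bar> \<le> e * (y - x)\<^sup>2 + C * (y - x) ^ 4"
  shows "\<exists>l\<ge>0. \<gamma> * l \<le> t \<and> x ^ 3 * l \<le> 18 * t\<^sup>2 \<and>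
      \<bar>sticky_semigroup P \<gamma> B L t f x - f x - t * (q / 2) - l * (p - \<gamma> / 2 * q - x * q)\<bar> \<le> e * t + C * (9 * t\<^sup>2)"
proof -
  interpret prob_space "P x" by (rule prob_space_P)
  note G = stopping_grid_Suc
  let ?\<tau> = "sticky_clock \<gamma> L t"
  note mf = grid_measurable[OF f] and limf = grid_sticky_tendsto[OF f] and msticky = sticky_measurable[OF f]
  have conv_f: "(\<lambda>m. \<integral>\<omega>. f \<bar>B (grid_time m \<omega>) \<omega>\<bar> \<partial>P x) \<longlonglongrightarrow> sticky_semigroup P \<gamma> B L t f x"
    unfolding sticky_semigroup_def
    by (rule integral_dominated_convergence[where w = "\<lambda>_. K"]) (use msticky mf limf K in auto)
  have iL: "integrable (P x) (\<lambda>\<omega>. L (grid_time m \<omega>) \<omega>)" and i\<sigma>: "integrable (P x) (grid_time m)" for m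
    using stopping_grid.stopped_tanaka(2)[OF G, of x m] stopping_grid.sigma_integrable[OF G, of x m]
    by (simp_all add: grid_time_def[abs_def])
  have limL: "(\<lambda>m. L (grid_time m \<omega>) \<omega>) \<longlonglongrightarrow> L (?\<tau> \<omega>) \<omega>" if "\<omega> \<in> space (P x)" for \<omega>
    using grid_path_tendsto[OF _ continuous_L] that by (simp add: space_P)
  have lim\<sigma>: "(\<lambda>m. grid_time m \<omega>) \<longlonglongrightarrow> ?\<tau> \<omega>" if "\<omega> \<in> space (P x)" for \<omega>
    using grid_time_tendsto that by (simp add: space_P)
  have mL: "(\<lambda>\<omega>. L (?\<tau> \<omega>) \<omega>) \<in> borel_measurable (P x)" and m\<tau>: "?\<tau> \<in> borel_measurable (P x)"
    using borel_measurable_LIMSEQ_real[OF limL borel_measurable_integrable[OF iL]]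
      borel_measurable_LIMSEQ_real[OF lim\<sigma> borel_measurable_integrable[OF i\<sigma>]] by auto
  have boundL: "\<bar>L (grid_time m \<omega>) \<omega>\<bar> \<le> L t \<omega>" if "\<omega> \<in> space (P x)" for m \<omega>
    using that grid_facts(1)[of \<omega> m] L_nonneg[of \<omega> "grid_time m \<omega>"]
      mono_onD[OF mono_L, of \<omega> "grid_time m \<omega>" t] by (simp add: space_P)
  have AE_L: "AE \<omega> in P x. (\<lambda>m. L (grid_time m \<omega>) \<omega>) \<longlonglongrightarrow> L (?\<tau> \<omega>) \<omega>"
    and AE_bL: "\<And>m. AE \<omega> in P x. norm (L (grid_time m \<omega>) \<omega>) \<le> L t \<omega>"
    using limL boundL by auto
  have iLt: "integrable (P x) (L t)" by (rule L_integrable) (use t in simp)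
  note domL = mL borel_measurable_integrable[OF iL] iLt AE_L AE_bL
  define l where "l = (\<integral>\<omega>. L (?\<tau> \<omega>) \<omega> \<partial>P x)"
  have conv_L: "(\<lambda>m. \<integral>\<omega>. L (grid_time m \<omega>) \<omega> \<partial>P x) \<longlonglongrightarrow> l"
    unfolding l_def by (rule integral_dominated_convergence[OF domL])
  have il: "integrable (P x) (\<lambda>\<omega>. L (?\<tau> \<omega>) \<omega>)"
    by (rule integrable_dominated_convergence[OF domL])
  have clock: "0 \<le> ?\<tau> \<omega>" "?\<tau> \<omega> \<le> t" "?\<tau> \<omega> + \<gamma> * L (?\<tau> \<omega>) \<omega> = t" if "\<omega> \<in> space (P x)" for \<omega>
    using sticky_clock_props[OF \<gamma>, of \<omega> t] that t by (simp_all add: space_P)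
  have conv_\<sigma>: "(\<lambda>m. \<integral>\<omega>. grid_time m \<omega> \<partial>P x) \<longlonglongrightarrow> (\<integral>\<omega>. ?\<tau> \<omega> \<partial>P x)"
    by (rule integral_dominated_convergence[where w = "\<lambda>_. t"])
       (use m\<tau> i\<sigma> lim\<sigma> grid_facts(1) in \<open>auto simp: space_P\<close>)
  \<comment> \<open>The relation \<tau> + \<gamma> L = t trades the mean of the clock for
    \<open>l\<close>, which brings the stickiness into the expansion.\<close>
  have "(\<integral>\<omega>. ?\<tau> \<omega> \<partial>P x) = (\<integral>\<omega>. t - \<gamma> * L (?\<tau> \<omega>) \<omega> \<partial>P x)"
    by (rule Bochner_Integration.integral_cong) (use clock(3) in \<open>auto simp: algebra_simps\<close>)
  also have "\<dots> = t - \<gamma> * l" using il by (simp add: l_def prob_space)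
  finally have E\<tau>: "(\<integral>\<omega>. ?\<tau> \<omega> \<partial>P x) = t - \<gamma> * l" .
  show ?thesis
  proof (intro exI[of _ l] conjI)
    show "0 \<le> l" unfolding l_def
      by (rule Bochner_Integration.integral_nonneg) (use clock(1) L_nonneg in \<open>simp add: space_P\<close>)
    have "0 \<le> (\<integral>\<omega>. ?\<tau> \<omega> \<partial>P x)"
      by (rule Bochner_Integration.integral_nonneg) (use clock(1) in simp)
    then show "\<gamma> * l \<le> t" using E\<tau> by simp
    show "x ^ 3 * l \<le> 18 * t\<^sup>2"
    proof (rule LIMSEQ_le_const2)
      show "(\<lambda>m. x ^ 3 * (\<integral>\<omega>. L (grid_time m \<omega>) \<omega> \<partial>P x)) \<longlonglongrightarrow> x ^ 3 * l"
        by (intro tendsto_intros conv_L)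
    qed (use stopping_grid.stopped_local_time_bound[OF G x] in \<open>auto simp: grid_time_def\<close>)
    have eq: "sticky_semigroup P \<gamma> B L t f x - f x - p * l - q / 2 * ((t - \<gamma> * l) - 2 * x * l) =
        sticky_semigroup P \<gamma> B L t f x - f x - t * (q / 2) - l * (p - \<gamma> / 2 * q - x * q)"
      by (simp add: field_simps)
    have "(\<lambda>m. \<bar>(\<integral>\<omega>. f \<bar>B (grid_time m \<omega>) \<omega>\<bar> \<partial>P x) - f x - p * (\<integral>\<omega>. L (grid_time m \<omega>) \<omega> \<partial>P x) -
        q / 2 * ((\<integral>\<omega>. grid_time m \<omega> \<partial>P x) - 2 * x * (\<integral>\<omega>. L (grid_time m \<omega>) \<omega> \<partial>P x))\<bar>) \<longlonglongrightarrow>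
      \<bar>sticky_semigroup P \<gamma> B L t f x - f x - p * l - q / 2 * ((t - \<gamma> * l) - 2 * x * l)\<bar>"
      using conv_\<sigma> unfolding E\<tau> by (intro tendsto_intros conv_f conv_L)
    from this[unfolded eq]
    show "\<bar>sticky_semigroup P \<gamma> B L t f x - f x - t * (q / 2) - l * (p - \<gamma> / 2 * q - x * q)\<bar>
        \<le> e * t + C * (9 * t\<^sup>2)"
      by (rule LIMSEQ_le_const2)
         (intro exI allI impI stopping_grid.stopped_taylor[OF G x f K e C taylor, folded grid_time_def])
  qed
qed

end

end

section \<open>The generator\<close>

context brownian_local_time
begin

lemma generator_of_domain:
  assumes \<gamma>: "0 < \<gamma>" and rep: "smooth_rep f f1 g" and bc: "\<gamma> / 2 * g 0 = f1 0"
  shows "generator_value (sticky_semigroup P \<gamma> B L) f (\<lambda>x. g x / 2)"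
  unfolding generator_value_def
proof (intro conjI)
  let ?U = "sticky_semigroup P \<gamma> B L"
  let ?\<psi> = "\<lambda>x. f1 x - \<gamma> / 2 * g x - x * g x"
  show f: "f \<in> C0_Rplus" and "(\<lambda>x. g x / 2) \<in> C0_Rplus"
    using rep tendsto_divide[OF _ tendsto_const, of g 0 at_top 2]
    by (auto simp: smooth_rep_def C0_Rplus_def intro!: continuous_intros)
  have cf: "continuous_on {0..} f" using f by (simp add: C0_Rplus_def)
  obtain K where K: "\<And>x. 0 \<le> x \<Longrightarrow> \<bar>f x\<bar> \<le> K"
    using C0_Rplus_bounded[OF f] by blast
  show "uniform_limit {0..} (\<lambda>t x. (?U t f x - f x) / t) (\<lambda>x. g x / 2) (at_right 0)"
  proof (rule uniform_limitI)
    fix e :: real assume e: "0 < e"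
    \<comment> \<open>After division by \<open>t\<close>, the Taylor error and the term with
      \<open>l\<close> near 0 contribute \<epsilon> each, together e / 2; the errors of order t^2
      will take less than e / 4.\<close>
    define \<epsilon> where "\<epsilon> = e / 4"
    have \<epsilon>: "0 < \<epsilon>" using e by (simp add: \<epsilon>_def)
    obtain C where C: "0 < C" and taylor: "\<And>x y. 0 \<le> x \<Longrightarrow> 0 \<le> y \<Longrightarrow>
        \<bar>f y - f x - f1 x * (y - x) - g x / 2 * (y - x)\<^sup>2\<bar> \<le> \<epsilon> * (y - x)\<^sup>2 + C * (y - x) ^ 4"
      using smooth_rep_taylor[OF rep \<epsilon>] by blast
    obtain D where D: "0 < D" "\<And>x. 0 \<le> x \<Longrightarrow> \<bar>?\<psi> x\<bar> \<le> D * (1 + x)"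
      using boundary_deficit(1)[OF rep bc \<gamma>] by blast
    \<comment> \<open>Since \<gamma> l \<le> t, a bound \<gamma> \<epsilon> on \<psi> near 0 makes l
      \<psi> at most \<epsilon> t.\<close>
    have "0 < \<gamma> * \<epsilon>" using \<gamma> \<epsilon> by simp
    then obtain d where d: "0 < d" "\<And>x. 0 \<le> x \<Longrightarrow> x < d \<Longrightarrow> \<bar>?\<psi> x\<bar> < \<gamma> * \<epsilon>"
      using boundary_deficit(2)[OF rep bc \<gamma>] by blast
    \<comment> \<open>9 C comes from the fourth moment; the rest from l \<le> 18 t^2 / x^3 and the
      bound D (1 + x) on \<psi> for x \<ge> d.\<close>
    define R where "R = 9 * C + 18 * D * (1 / d ^ 3 + 1 / d\<^sup>2)"
    have R: "0 < R" unfolding R_def using C D d by (intro add_pos_pos mult_pos_pos) auto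
    have main: "\<bar>(?U t f x - f x) / t - g x / 2\<bar> \<le> 2 * \<epsilon> + R * t" if t: "0 < t" and x: "0 \<le> x" for t x
    proof -
      from sticky_expansion[OF \<gamma> t x cf K less_imp_le[OF \<epsilon>] less_imp_le[OF C] taylor[OF x]]
      obtain l where l: "0 \<le> l" "\<gamma> * l \<le> t" "x ^ 3 * l \<le> 18 * t\<^sup>2"
        and bound: "\<bar>?U t f x - f x - t * (g x / 2) - l * ?\<psi> x\<bar> \<le> \<epsilon> * t + C * (9 * t\<^sup>2)" by blast
      have "l * \<bar>?\<psi> x\<bar> \<le> \<epsilon> * t + 18 * D * (1 / d ^ 3 + 1 / d\<^sup>2) * t\<^sup>2"
      proof (cases "x < d")
        case True
        have "l * \<bar>?\<psi> x\<bar> \<le> l * (\<gamma> * \<epsilon>)"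
          using d(2)[OF x True] l(1) by (intro mult_left_mono) auto
        also have "\<dots> = (\<gamma> * l) * \<epsilon>" by simp
        also have "\<dots> \<le> t * \<epsilon>" using l(2) \<epsilon> by (intro mult_right_mono) auto
        also have "\<dots> \<le> \<epsilon> * t + 18 * D * (1 / d ^ 3 + 1 / d\<^sup>2) * t\<^sup>2"
          using D d by simp
        finally show ?thesis .
      next
        case False
        then have dx: "d \<le> x" "0 < x" using d by auto
        have "l \<le> 18 * t\<^sup>2 * (1 / x ^ 3)" using l(3) dx by (simp add: field_simps)
        then have "l * \<bar>?\<psi> x\<bar> \<le> (18 * t\<^sup>2 * (1 / x ^ 3)) * (D * (1 + x))"
          using D(2)[OF x] dx by (intro mult_mono) auto
        also have "\<dots> = 18 * D * (1 / x ^ 3 + 1 / x\<^sup>2) * t\<^sup>2"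
          using dx by (simp add: field_simps power2_eq_square power3_eq_cube)
        also have "\<dots> \<le> 18 * D * (1 / d ^ 3 + 1 / d\<^sup>2) * t\<^sup>2"
          using D d dx by (intro mult_right_mono mult_left_mono add_mono frac_le power_mono) auto
        also have "\<dots> \<le> \<epsilon> * t + 18 * D * (1 / d ^ 3 + 1 / d\<^sup>2) * t\<^sup>2" using \<epsilon> t by simp
        finally show ?thesis .
      qed
      moreover have "\<bar>l * ?\<psi> x\<bar> = l * \<bar>?\<psi> x\<bar>" using l(1) by (simp add: abs_mult)
      ultimately have "\<bar>l * ?\<psi> x\<bar> \<le> \<epsilon> * t + 18 * D * (1 / d ^ 3 + 1 / d\<^sup>2) * t\<^sup>2" by simp
      note sum_bound = add_mono[OF bound this]
      have "\<bar>a\<bar> \<le> \<bar>a - b\<bar> + \<bar>b\<bar>" for a b :: real by simp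
      from order_trans[OF this sum_bound]
      have "\<bar>?U t f x - f x - t * (g x / 2)\<bar> \<le>
          \<epsilon> * t + C * (9 * t\<^sup>2) + (\<epsilon> * t + 18 * D * (1 / d ^ 3 + 1 / d\<^sup>2) * t\<^sup>2)" .
      also have "\<dots> = (2 * \<epsilon> + R * t) * t"
        unfolding R_def by (simp add: distrib_left distrib_right power2_eq_square mult_ac)
      finally have "\<bar>?U t f x - f x - t * (g x / 2)\<bar> / t \<le> 2 * \<epsilon> + R * t"
        using t by (simp add: divide_le_eq)
      moreover have "(?U t f x - f x) / t - g x / 2 = (?U t f x - f x - t * (g x / 2)) / t"
        using t by (simp add: field_simps)
      ultimately show ?thesis using t by simp
    qed
    have "\<forall>\<^sub>F t in at_right 0. t < e / (4 * R)"
      using e R by (intro order_tendstoD(2)[OF tendsto_ident_at]) simp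
    then show "\<forall>\<^sub>F t in at_right 0. \<forall>x\<in>{0..}. dist ((?U t f x - f x) / t) (g x / 2) < e"
      using eventually_at_right_less[of 0]
    proof eventually_elim
      case (elim t)
      have "R * t < e / 4" using elim R by (simp add: field_simps)
      then have "2 * \<epsilon> + R * t < e" using e by (simp add: \<epsilon>_def)
      then show ?case using main[OF elim(2)] by (force simp: dist_real_def)
    qed
  qed
qed

text \<open>Positive maximum principle: \<open>U\<^sub>t\<close> averages over the half-line, so \<open>A u \<le> 0\<close> wherever \<open>u\<close> attains a
  positive maximum.\<close>

lemma sticky_generator_dissipative:
  assumes \<gamma>: "0 < \<gamma>" and u: "generator_value (sticky_semigroup P \<gamma> B L) u (\<lambda>x. u x / 2)" and x: "0 \<le> x"
  shows "u x \<le> 0"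
proof (rule ccontr)
  assume "\<not> u x \<le> 0"
  then have pos: "0 < u x" by simp
  have C0: "u \<in> C0_Rplus" and lim: "uniform_limit {0..}
      (\<lambda>t x. (sticky_semigroup P \<gamma> B L t u x - u x) / t) (\<lambda>x. u x / 2) (at_right 0)"
    using u by (auto simp: generator_value_def)
  have cu: "continuous_on {0..} u" and lim0: "(u \<longlongrightarrow> 0) at_top" using C0 by (auto simp: C0_Rplus_def)
  \<comment> \<open>As u x > 0, values beyond \<open>N\<close> stay below \<open>u x\<close>, so the
    maximum over a compact interval is global.\<close>
  have "\<forall>\<^sub>F y in at_top. u y < u x" by (rule order_tendstoD(2)[OF lim0 pos])
  then obtain N where N: "\<And>y. N \<le> y \<Longrightarrow> u y < u x" by (auto simp: eventually_at_top_linorder)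
  have "continuous_on {0..max x N} u" by (rule continuous_on_subset[OF cu]) auto
  then obtain z where z: "z \<in> {0..max x N}" "\<And>y. y \<in> {0..max x N} \<Longrightarrow> u y \<le> u z"
    using continuous_attains_sup[of "{0..max x N}" u] x by fastforce
  have zx: "u x \<le> u z" using z(2)[of x] x by simp
  have max: "u y \<le> u z" if "0 \<le> y" for y
  proof (cases "y \<le> max x N")
    case True
    then show ?thesis using z(2)[of y] that by simp
  next
    case False
    then have "N \<le> y" by (simp add: max_def split: if_splits)
    then show ?thesis using N[of y] zx by simp
  qed
  have le: "(sticky_semigroup P \<gamma> B L t u z - u z) / t \<le> 0" if t: "0 < t" for t
  proof -
    interpret prob_space "P z" by (rule prob_space_P)
    have "sticky_semigroup P \<gamma> B L t u z \<le> (\<integral>\<omega>. u z \<partial>P z)"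
      unfolding sticky_semigroup_def
      by (intro integral_mono sticky_semigroup_integrable[OF \<gamma> t C0])
         (auto intro!: max simp: sticky_bm_def)
    then show ?thesis using t by (simp add: prob_space divide_le_0_iff)
  qed
  have "((\<lambda>t. (sticky_semigroup P \<gamma> B L t u z - u z) / t) \<longlongrightarrow> u z / 2) (at_right 0)"
    by (rule tendsto_uniform_limitI[OF lim]) (use z in auto)
  then have "u z / 2 \<le> 0"
    by (rule tendsto_upperbound)
       (use eventually_at_right_less[of 0] le in \<open>auto elim: eventually_mono\<close>)
  then show False using pos zx by simp
qed

text \<open>Splitting the expectation uses integrability of both terms, available for t > 0, which
  is all that the limit sees.\<close>

lemma generator_value_diff:
  assumes \<gamma>: "0 < \<gamma>" and f: "generator_value (sticky_semigroup P \<gamma> B L) f a"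
    and g: "generator_value (sticky_semigroup P \<gamma> B L) g b"
  shows "generator_value (sticky_semigroup P \<gamma> B L) (\<lambda>x. f x - g x) (\<lambda>x. a x - b x)"
  unfolding generator_value_def
proof (intro conjI)
  let ?U = "sticky_semigroup P \<gamma> B L"
  have C0_diff: "(\<lambda>x. p x - q x) \<in> C0_Rplus" if "p \<in> C0_Rplus" "q \<in> C0_Rplus" for p q
    using that tendsto_diff[of p 0 at_top q 0] by (auto simp: C0_Rplus_def intro!: continuous_intros)
  show "(\<lambda>x. f x - g x) \<in> C0_Rplus" "(\<lambda>x. a x - b x) \<in> C0_Rplus"
    using f g by (auto simp: generator_value_def intro: C0_diff)
  have fC: "f \<in> C0_Rplus" and gC: "g \<in> C0_Rplus" using f g by (auto simp: generator_value_def)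
  have "uniform_limit {0..} (\<lambda>t x. (?U t f x - f x) / t - (?U t g x - g x) / t) (\<lambda>x. a x - b x) (at_right 0)"
    using f g by (intro uniform_limit_minus) (auto simp: generator_value_def)
  then show "uniform_limit {0..} (\<lambda>t x. (?U t (\<lambda>x. f x - g x) x - (f x - g x)) / t) (\<lambda>x. a x - b x) (at_right 0)"
  proof (rule uniform_limit_cong[THEN iffD1, rotated 2])
    show "\<forall>\<^sub>F t in at_right 0. \<forall>x\<in>{0..}. (?U t f x - f x) / t - (?U t g x - g x) / t =
        (?U t (\<lambda>x. f x - g x) x - (f x - g x)) / t"
      using eventually_at_right_less[of 0]
    proof eventually_elim
      case (elim t)
      then have "?U t (\<lambda>x. f x - g x) x = ?U t f x - ?U t g x" for x
        unfolding sticky_semigroup_def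
        using sticky_semigroup_integrable[OF \<gamma> elim fC] sticky_semigroup_integrable[OF \<gamma> elim gC] by simp
      then show ?case by (simp add: diff_divide_distrib)
    qed
  qed auto
qed

lemma generator_domain_sticky:
  assumes \<gamma>: "0 < \<gamma>"
  shows "generator_domain (sticky_semigroup P \<gamma> B L) =
    {f \<in> C02_Rplus. \<gamma> / 2 * right_deriv2_0 f = right_deriv_0 f}"
proof (intro set_eqI iffI)
  fix f assume "f \<in> {f \<in> C02_Rplus. \<gamma> / 2 * right_deriv2_0 f = right_deriv_0 f}"
  then have f: "f \<in> C02_Rplus" and bc: "\<gamma> / 2 * right_deriv2_0 f = right_deriv_0 f" by auto
  obtain f1 g where rep: "smooth_rep f f1 g" using C02_smooth_rep[OF f] by blast
  have "\<gamma> / 2 * g 0 = f1 0" using bc smooth_rep_C02[OF rep] by simp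
  from generator_of_domain[OF \<gamma> rep this]
  show "f \<in> generator_domain (sticky_semigroup P \<gamma> B L)"
    unfolding generator_domain_def by blast
next
  fix f assume "f \<in> generator_domain (sticky_semigroup P \<gamma> B L)"
  then obtain a where a: "generator_value (sticky_semigroup P \<gamma> B L) f a"
    unfolding generator_domain_def by blast
  have f: "f \<in> C0_Rplus" and aC: "a \<in> C0_Rplus" using a by (auto simp: generator_value_def)
  \<comment> \<open>\<open>k\<close> is 2 (1/2 - A) f, and h - h'' = k is the equation (1/2 - A) h =
    (1/2 - A) f when A h is half the second derivative.\<close>
  define k where "k x = f x - 2 * a x" for x
  have k: "k \<in> C0_Rplus"
    using f aC tendsto_diff[of f 0 at_top "\<lambda>x. 2 * a x" 0] tendsto_mult_right_zero[of a at_top 2]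
    by (auto simp: C0_Rplus_def k_def[abs_def] intro!: continuous_intros)
  obtain v v1 where rep: "smooth_rep v v1 (\<lambda>x. v x - k x)" and bc: "\<gamma> / 2 * (v 0 - k 0) = v1 0"
    using resolvent_equation[OF k \<gamma>] by blast
  note v = generator_of_domain[OF \<gamma> rep bc]
  \<comment> \<open>Both differences satisfy A u = u / 2, so the maximum principle gives the two
    inequalities.\<close>
  have eq: "f x = v x" if "0 \<le> x" for x
  proof (rule antisym)
    have "(\<lambda>x. a x - (v x - k x) / 2) = (\<lambda>x. (f x - v x) / 2)"
      by (auto simp: k_def field_simps)
    with generator_value_diff[OF \<gamma> a v]
    show "f x \<le> v x" using sticky_generator_dissipative[OF \<gamma>, of "\<lambda>x. f x - v x" x] that by simp
    have "(\<lambda>x. (v x - k x) / 2 - a x) = (\<lambda>x. (v x - f x) / 2)"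
      by (auto simp: k_def field_simps)
    with generator_value_diff[OF \<gamma> v a]
    show "v x \<le> f x" using sticky_generator_dissipative[OF \<gamma>, of "\<lambda>x. v x - f x" x] that by simp
  qed
  \<comment> \<open>\<open>f\<close> and \<open>v\<close> agree on [0, \<infinity>) only, which
    suffices for derivatives within the half-line.\<close>
  have "(f has_real_derivative v1 x) (at x within {0..})" if "0 \<le> x" for x
    by (rule has_field_derivative_transform_within[where d = 1 and f = v])
       (use rep that eq in \<open>auto simp: smooth_rep_def\<close>)
  then have rep_f: "smooth_rep f v1 (\<lambda>x. v x - k x)"
    using rep f by (simp add: smooth_rep_def)
  then show "f \<in> {f \<in> C02_Rplus. \<gamma> / 2 * right_deriv2_0 f = right_deriv_0 f}"
    using smooth_rep_C02[OF rep_f] bc by simp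
qed

end

theorem theorem3p5:
  fixes M :: "'a measure"
    and P F :: "real \<Rightarrow> 'a measure"
    and B L :: "real \<Rightarrow> 'a \<Rightarrow> real"
    and \<theta> :: "real \<Rightarrow> 'a \<Rightarrow> 'a"
    and \<gamma> :: real
  assumes "brownian_local_time M P F B \<theta> L"
    and "\<gamma> > 0"
  shows "generator_domain (sticky_semigroup P \<gamma> B L) =
    {f \<in> C02_Rplus. \<gamma> / 2 * right_deriv2_0 f = right_deriv_0 f}"
  using brownian_local_time.generator_domain_sticky[OF assms] .

end
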